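(* Let $\{x^t\}_{t\ge 0}$ be the sequence of iterates generated by the IQN method applied to $f=\frac1n\sum_{i=1}^n f_i$, where the $f_i$ satisfy the following two assumptions. (1) There are constants $0<\mu\le L$ with $\mu\|x-\hat x\|^2\le(\nabla f_i(x)-\nabla f_i(\hat x))^T(x-\hat x)\le L\|x-\hat x\|^2$ for all $i$ and all $x,\hat x\in\mathbb{R}^p$. (2) There is a constant $\tilde L>0$ with $\|\nabla^2 f_i(x)-\nabla^2 f_i(\hat x)\|\le\tilde L\|x-\hat x\|$ for all $i$ and all $x,\hat x\in\mathbb{R}^p$. Let $r\in(0,1)$ and let $(\epsilon(r),\delta(r))$ be an $r$-admissible pair (defined in the context). Suppose that $\|x^0-x^*\|<\epsilon(r)$, that $\|B_i^0-\nabla^2 f_i(x^* )\|_{M_i}<\delta(r)$ for $i=1,\dots,n$, where $M_i=\nabla^2 f_i(x^* )^{-1/2}$, and that for every $t\ge0$, with $i=i_t$, the quantity $\sigma_i^t:=\max\{\|z_i^{t+1}-x^*\|,\|z_i^t-x^*\|\}$ satisfies $\sigma_i^t<\mu/(3\tilde L)$. Then there exists a subsequence of $\{\|x^t-x^*\|\}$ that converges to zero superlinearly. Moreover, there exists a sequence $\{\zeta^t\}_{t\ge0}$ such that $\|x^t-x^*\|\le\zeta^t$ for all $t\ge0$, and $\zeta^t$ converges to zero at a superlinear rate, i.e. $$\lim_{t\to\infty}\frac{\zeta^{t+1}}{\zeta^t}=0.$$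
   Context: Let $f_1,\dots,f_n:\mathbb{R}^p\to\mathbb{R}$ be twice differentiable, $f=\frac1n\sum_{i=1}^n f_i$, and let $x^*$ be the unique minimizer of $f$ over $\mathbb{R}^p$. $\|\cdot\|$ is the Euclidean norm for vectors and the induced norm for matrices. For a positive definite matrix $M$, $\|A\|_M:=\|MAM\|_F$, with $\|\cdot\|_F$ the Frobenius norm. A sequence of positive numbers $e_k$ converges to zero superlinearly if $e_k\to0$ and $\lim_{k\to\infty}e_{k+1}/e_k=0$. IQN method. Inputs: $x^0\in\mathbb{R}^p$ and symmetric positive definite matrices $B_1^0,\dots,B_n^0\in\mathbb{R}^{p\times p}$. Set $z_1^0=\dots=z_n^0=x^0$. For $t=0,1,2,\dots$: - let $i_t=(t \bmod n)+1$; - set $x^{t+1}=\left(\frac1n\sum_{i=1}^n B_i^t\right)^{-1}\left[\frac1n\sum_{i=1}^n B_i^t z_i^t-\frac1n\sum_{i=1}^n\nabla f_i(z_i^t)\right]$; - set $z_{i_t}^{t+1}=x^{t+1}$ and $z_i^{t+1}=z_i^t$ for $i\ne i_t$; - with $s_i^t=z_i^{t+1}-z_i^t$ and $y_i^t=\nabla f_i(z_i^{t+1})-\nabla f_i(z_i^t)$, set for $i=i_t$ $$B_i^{t+1}=B_i^t+\frac{y_i^t (y_i^t)^T}{(y_i^t)^T s_i^t}-\frac{B_i^t s_i^t (s_i^t)^T B_i^t}{(s_i^t)^T B_i^t s_i^t},$$ and $B_i^{t+1}=B_i^t$ for $i\neq i_t$. It is understood that $s_{i_t}^t\ne0$ for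 all $t$, so that the updates are well defined. $r$-admissible pair: for fixed $f_1,\dots,f_n$ and $r\in(0,1)$, a pair of positive constants $(\epsilon(r),\delta(r))$ is called $r$-admissible if, for every initialization with $\|x^0-x^*\|<\epsilon(r)$ and $\|B_i^0-\nabla^2 f_i(x^* )\|_{M_i}<\delta(r)$, $M_i=\nabla^2 f_i(x^* )^{-1/2}$, $i=1,\dots,n$, the IQN iterates satisfy $\|x^t-x^*\|\le r^{\lfloor (t-1)/n\rfloor+1}\|x^0-x^*\|$ for all $t$, and the sequences $\{\|B_i^t\|\}$ and $\{\|(B_i^t)^{-1}\|\}$ are uniformly bounded. *)

theory Defs
  imports "HOL-Analysis.Analysis"
begin

definition gradient :: "('a::real_inner \<Rightarrow> real) \<Rightarrow> 'a \<Rightarrow> 'a" where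
  "gradient f x = (THE D. GDERIV f x :> D)"

definition hessian :: "(real^'p \<Rightarrow> real) \<Rightarrow> real^'p \<Rightarrow> real^'p^'p" where
  "hessian f x = jacobian (gradient f) (at x)"

definition twice_differentiable :: "(real^'p \<Rightarrow> real) \<Rightarrow> bool" where
  "twice_differentiable f \<longleftrightarrow>
     (\<forall>x. f differentiable (at x)) \<and> (\<forall>x. gradient f differentiable (at x))"

definition unique_minimizer :: "('a \<Rightarrow> real) \<Rightarrow> 'a \<Rightarrow> bool" where
  "unique_minimizer F xs \<longleftrightarrow> (\<forall>y. F xs \<le> F y) \<and> (\<forall>w. (\<forall>y. F w \<le> F y) \<longrightarrow> w = xs)"

definition sym_pos_def :: "real^'p^'p \<Rightarrow> bool" where
  "sym_pos_def A \<longleftrightarrow> transpose A = A \<and> (\<forall>v. v \<noteq> 0 \<longrightarrow> 0 < v \<bullet> (A *v v))"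

definition induced_norm :: "real^'p^'p \<Rightarrow> real" where
  "induced_norm A = onorm (\<lambda>v. A *v v)"

text \<open>The library norm on \<^typ>\<open>real^'p^'p\<close> is the Euclidean norm of the
  vector of Euclidean norms of the rows, that is, the Frobenius norm.\<close>

definition weighted_norm :: "real^'p^'p \<Rightarrow> real^'p^'p \<Rightarrow> real" where
  "weighted_norm M A = norm (M ** A ** M)"

text \<open>The principal root \<open>A\<^sup>-\<^sup>1\<^sup>/\<^sup>2\<close>; only meaningful for symmetric positive definite \<open>A\<close>.\<close>

definition inv_sqrt :: "real^'p^'p \<Rightarrow> real^'p^'p" where
  "inv_sqrt A = (THE M. sym_pos_def M \<and> M ** M = matrix_inv A)"

definition outer_prod :: "real^'p \<Rightarrow> real^'p \<Rightarrow> real^'p^'p" where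
  "outer_prod u v = (\<chi> i j. u $ i * v $ j)"

definition bfgs_update :: "real^'p^'p \<Rightarrow> real^'p \<Rightarrow> real^'p \<Rightarrow> real^'p^'p" where
  "bfgs_update B s y =
     B + (1 / (y \<bullet> s)) *\<^sub>R outer_prod y y
       - (1 / (s \<bullet> (B *v s))) *\<^sub>R (B ** outer_prod s s ** B)"

definition iqn_index :: "nat \<Rightarrow> nat \<Rightarrow> nat" where
  "iqn_index n t = t mod n + 1"

text \<open>\<open>x\<close>, \<open>z\<close>, \<open>B\<close> are the sequences of iterates, auxiliary points and Hessian approximations
  (\<open>z t i\<close> and \<open>B t i\<close> for \<open>1 \<le> i \<le> n\<close>) of a run of the method initialized with
  \<open>x 0\<close> and \<open>B 0\<close>. Nonvanishing of every step \<open>s\<close>, without which the update is undefined,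
  is part of being a run.\<close>

definition iqn_run ::
  "nat \<Rightarrow> (nat \<Rightarrow> real^'p \<Rightarrow> real) \<Rightarrow> (nat \<Rightarrow> real^'p) \<Rightarrow> (nat \<Rightarrow> nat \<Rightarrow> real^'p)
    \<Rightarrow> (nat \<Rightarrow> nat \<Rightarrow> real^'p^'p) \<Rightarrow> bool" where
  "iqn_run n f x z B \<longleftrightarrow>
     (\<forall>i\<in>{1..n}. z 0 i = x 0 \<and> sym_pos_def (B 0 i)) \<and>
     (\<forall>t. x (Suc t) =
            matrix_inv ((1 / real n) *\<^sub>R (\<Sum>i\<in>{1..n}. B t i)) *v
              ((1 / real n) *\<^sub>R (\<Sum>i\<in>{1..n}. B t i *v z t i)
               - (1 / real n) *\<^sub>R (\<Sum>i\<in>{1..n}. gradient (f i) (z t i)))) \<and>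
     (\<forall>t. \<forall>i\<in>{1..n}. z (Suc t) i = (if i = iqn_index n t then x (Suc t) else z t i)) \<and>
     (\<forall>t. \<forall>i\<in>{1..n}. B (Suc t) i =
            (if i = iqn_index n t
             then bfgs_update (B t i) (z (Suc t) i - z t i)
                    (gradient (f i) (z (Suc t) i) - gradient (f i) (z t i))
             else B t i)) \<and>
     (\<forall>t. z (Suc t) (iqn_index n t) - z t (iqn_index n t) \<noteq> 0)"

definition iqn_init_close ::
  "nat \<Rightarrow> (nat \<Rightarrow> real^'p \<Rightarrow> real) \<Rightarrow> real^'p \<Rightarrow> real \<Rightarrow> real \<Rightarrow> real^'p
    \<Rightarrow> (nat \<Rightarrow> real^'p^'p) \<Rightarrow> bool" where
  "iqn_init_close n f xs \<epsilon> \<delta> x0 B0 \<longleftrightarrow>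
     norm (x0 - xs) < \<epsilon> \<and>
     (\<forall>i\<in>{1..n}. weighted_norm (inv_sqrt (hessian (f i) xs)) (B0 i - hessian (f i) xs) < \<delta>)"

text \<open>For \<open>t = 0\<close> the exponent \<open>\<lfloor>(t - 1) / n\<rfloor> + 1\<close> is \<open>0\<close>.\<close>

definition admissible_pair ::
  "nat \<Rightarrow> (nat \<Rightarrow> real^'p \<Rightarrow> real) \<Rightarrow> real^'p \<Rightarrow> real \<Rightarrow> real \<Rightarrow> real \<Rightarrow> bool" where
  "admissible_pair n f xs r \<epsilon> \<delta> \<longleftrightarrow>
     0 < \<epsilon> \<and> 0 < \<delta> \<and>
     (\<forall>x z B. iqn_run n f x z B \<and> iqn_init_close n f xs \<epsilon> \<delta> (x 0) (B 0) \<longrightarrow>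
        (\<forall>t. norm (x t - xs) \<le> r powi (\<lfloor>(real t - 1) / real n\<rfloor> + 1) * norm (x 0 - xs)) \<and>
        (\<exists>C. \<forall>i\<in>{1..n}. \<forall>t. induced_norm (B t i) \<le> C \<and> induced_norm (matrix_inv (B t i)) \<le> C))"

definition superlinear_to_zero :: "(nat \<Rightarrow> real) \<Rightarrow> bool" where
  "superlinear_to_zero e \<longleftrightarrow>
     (\<forall>k. 0 < e k) \<and> e \<longlonglongrightarrow> 0 \<and> (\<lambda>k. e (Suc k) / e k) \<longlonglongrightarrow> 0"

end

(* Let E be the error B_i - H_i of the Hessian approximation of f_i, with H_i the Hessian of f_i at the
   minimizer. The potential tr((H_i^-1 B_i - 1)^2) decreases along BFGS updates up to a summable
   perturbation, which gives the Dennis-More condition |E s| = o(|s|) and shows that E varies more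
   and more slowly. The new error x^(t+1) - x* is controlled by the terms E u with u = z_i - x*, but
   the Dennis-More condition only concerns the increments s of u. Since u tends to zero, -u is the
   sum of all its later increments; R-linear convergence and the slow variation of E then make E u
   small compared with a geometrically weighted supremum S of the present and future errors. Thus S
   decreases by a factor tending to zero every n + 1 steps, and a geometric mean of n + 1 consecutive
   values of S is the required majorant. *)
theory Submission
  imports Defs
begin

section \<open>Matrices and the BFGS update\<close>

text \<open>Nothing here makes B_i converge to H_i, so E is merely bounded. Replacing u once by -s
  plus the next u would therefore not help: E applied to that remainder has the size of a new error,
  with a factor that need not be small. This forces the telescoping to infinity, and with it the
  slow variation of E, since the Dennis-More bound on a later increment concerns the later E. The
  price is that errors occurring after the one to be estimated enter its bound, so S has to look
  forward. Its weight rho = r^(1/n) is the ratio implied by admissibility; it makes S finite and the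
  sums over all later increments converge. The shift n + 1 comes from the cyclic order: a stored
  point z_i is at most n iterates old, so at time t + n all stored points are iterates from time t
  on, and the next iterate is x^(t+n+1). The uniform bound on the inverses of the B_i supplies the
  coercivity used throughout.\<close>

lemma symmetric_matrix_inner:
  fixes A :: "real^'n^'n"
  assumes "transpose A = A"
  shows "u \<bullet> (A *v v) = v \<bullet> (A *v u)"
  by (metis assms dot_lmul_matrix inner_commute transpose_matrix_vector)

lemma symmetric_matrixI:
  fixes A :: "real^'n^'n"
  assumes "\<And>u v. u \<bullet> (A *v v) = v \<bullet> (A *v u)"
  shows "transpose A = A"
proof -
  have "transpose A *v v = A *v v" for v
    by (rule vector_eq_rdot[THEN iffD1])
       (metis assms dot_lmul_matrix inner_commute transpose_matrix_vector)
  then show ?thesis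
    by (simp add: matrix_eq)
qed

section \<open>Outer products, traces and the Frobenius norm\<close>

lemma outer_prod_mult_vec: "outer_prod u v *v w = (v \<bullet> w) *\<^sub>R u"
  by (simp add: vec_eq_iff outer_prod_def matrix_vector_mult_def inner_vec_def
      sum_distrib_left sum_distrib_right mult_ac)

lemma matrix_mult_outer_prod: "A ** outer_prod u v = outer_prod (A *v u) v"
  by (simp add: matrix_eq matrix_vector_mul_assoc[symmetric] outer_prod_mult_vec
      matrix_vector_mult_scaleR)

lemma outer_prod_mult_matrix: "outer_prod u v ** A = outer_prod u (transpose A *v v)"
  by (simp add: matrix_eq matrix_vector_mul_assoc[symmetric] outer_prod_mult_vec dot_lmul_matrix)

lemma trace_mult_outer_prod: "trace (A ** outer_prod u v) = v \<bullet> (A *v u)"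
  by (simp add: trace_def matrix_mult_outer_prod) (simp add: outer_prod_def inner_vec_def mult.commute)

lemma norm_outer_prod: "norm (outer_prod u v) = norm u * norm v"
proof -
  have "outer_prod u v $ i = (u $ i) *\<^sub>R v" for i
    by (simp add: vec_eq_iff outer_prod_def)
  then have "norm (outer_prod u v) = L2_set (\<lambda>i. \<bar>u $ i\<bar> * norm v) UNIV"
    by (simp add: norm_vec_def[of "outer_prod u v"])
  also have "\<dots> = norm u * norm v"
    by (simp add: L2_set_left_distrib[symmetric] norm_vec_def[of u])
  finally show ?thesis .
qed

lemma matrix_mult_add_left: "(A + B) ** C = A ** C + B ** C"
  for A B :: "real^'n^'m" and C :: "real^'p^'n"
  by (simp add: matrix_eq matrix_vector_mul_assoc[symmetric] matrix_vector_mult_add_rdistrib)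

lemma bilinear_matrix_mult: "bilinear ((**) :: real^'n^'m \<Rightarrow> real^'p^'n \<Rightarrow> real^'p^'m)"
  by (simp add: bilinear_def linear_iff matrix_add_ldistrib matrix_mult_add_left
      matrix_scalar_ac scalar_matrix_assoc[symmetric])

lemma trace_scaleR: "trace (c *\<^sub>R A) = c * trace A" for A :: "real^'n^'n"
  by (simp add: trace_def sum_distrib_left)

lemma bilinear_trace_mult: "bilinear (\<lambda>A B. trace (A ** B) :: real)"
  for A :: "real^'n^'n" and B :: "real^'n^'n"
  by (simp add: bilinear_def linear_iff matrix_add_ldistrib matrix_mult_add_left trace_add
      matrix_scalar_ac scalar_matrix_assoc[symmetric] trace_scaleR)

lemma bounded_bilinear_matrix_mult: "bounded_bilinear ((**) :: real^'n^'m \<Rightarrow> real^'p^'n \<Rightarrow> real^'p^'m)"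
  using bilinear_matrix_mult bilinear_conv_bounded_bilinear by blast

text \<open>Admissibility bounds induced norms, whereas the potential argument works with the
  Frobenius norm \<open>norm\<close>. The crude dimension factor is harmless, as only boundedness
  matters.\<close>

lemma norm_matrix_le_onorm:
  "norm (A :: real^'n^'m) \<le> real (CARD('m)) * real (CARD('n)) * onorm ((*v) A)"
proof -
  have "norm (A $ i) \<le> real (CARD('n)) * onorm ((*v) A)" for i
  proof -
    have "norm (A $ i) \<le> (\<Sum>j\<in>UNIV. \<bar>A $ i $ j\<bar>)"
      by (rule norm_le_l1_cart)
    also have "\<dots> \<le> (\<Sum>j::'n\<in>UNIV. onorm ((*v) A))"
      by (intro sum_mono matrix_component_le_onorm)
    finally show ?thesis by simp
  qed
  moreover have "norm A \<le> (\<Sum>i\<in>UNIV. norm (A $ i))"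
    by (simp add: norm_vec_def L2_set_le_sum)
  ultimately have "norm A \<le> (\<Sum>i::'m\<in>UNIV. real (CARD('n)) * onorm ((*v) A))"
    by (meson order_trans sum_mono)
  then show ?thesis by simp
qed

lemma norm_mult_vec_le: "norm (A *v v) \<le> norm A * norm v" for A :: "real^'n^'m"
proof -
  have "norm (A *v v) = L2_set (\<lambda>i. norm (A $ i \<bullet> v)) UNIV"
    by (simp add: norm_vec_def[of "A *v v"] matrix_vector_mul_component)
  also have "\<dots> \<le> L2_set (\<lambda>i. norm (A $ i) * norm v) UNIV"
    by (rule L2_set_mono) (simp_all add: Cauchy_Schwarz_ineq2)
  also have "\<dots> = norm A * norm v"
    by (simp add: L2_set_left_distrib[symmetric] norm_vec_def[of A])
  finally show ?thesis .
qed

lemma norm_mult_vec_le_induced_norm: "norm (A *v v) \<le> induced_norm A * norm v"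
  unfolding induced_norm_def by (rule onorm[OF matrix_vector_mul_bounded_linear])

section \<open>Positive definite matrices\<close>

lemma positive_matrix_Cauchy_Schwarz:
  fixes A :: "real^'n^'n"
  assumes sym: "\<And>u v. u \<bullet> (A *v v) = v \<bullet> (A *v u)"
    and nonneg: "\<And>v. 0 \<le> v \<bullet> (A *v v)"
    and pos: "0 < u \<bullet> (A *v u)"
  shows "(u \<bullet> (A *v v))\<^sup>2 \<le> (u \<bullet> (A *v u)) * (v \<bullet> (A *v v))"
proof -
  \<comment> \<open>With this \<open>c\<close>, the vector \<open>v - c *\<^sub>R u\<close> is the
    component of \<open>v\<close> that is \<open>A\<close>-orthogonal to \<open>u\<close>.\<close>
  define c where "c = (u \<bullet> (A *v v)) / (u \<bullet> (A *v u))"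
  have "0 \<le> (v - c *\<^sub>R u) \<bullet> (A *v (v - c *\<^sub>R u))"
    by (rule nonneg)
  also have "\<dots> = v \<bullet> (A *v v) - 2 * c * (u \<bullet> (A *v v)) + c\<^sup>2 * (u \<bullet> (A *v u))"
    by (simp add: algebra_simps inner_diff_left inner_diff_right power2_eq_square sym[of v u])
  also have "\<dots> = v \<bullet> (A *v v) - (u \<bullet> (A *v v))\<^sup>2 / (u \<bullet> (A *v u))"
    using pos by (simp add: c_def field_simps power2_eq_square)
  finally show ?thesis
    using pos by (simp add: field_simps)
qed

lemma sym_pos_defD:
  assumes "sym_pos_def A"
  shows "u \<bullet> (A *v v) = v \<bullet> (A *v u)" "v \<noteq> 0 \<Longrightarrow> 0 < v \<bullet> (A *v v)" "0 \<le> v \<bullet> (A *v v)"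
  using assms symmetric_matrix_inner[of A] unfolding sym_pos_def_def
  by (blast, blast, cases "v = 0") (auto simp: less_imp_le)

lemma positive_imp_invertible:
  fixes A :: "real^'n^'n"
  assumes "\<And>v. v \<noteq> 0 \<Longrightarrow> 0 < v \<bullet> (A *v v)"
  shows "invertible A"
proof -
  have "A *v v = 0 \<Longrightarrow> v = 0" for v
    using assms[of v] by (metis inner_zero_right less_irrefl)
  then show ?thesis
    by (metis invertible_left_inverse matrix_left_invertible_ker)
qed

lemma matrix_inv_mult:
  fixes A :: "real^'n^'n"
  assumes "invertible A"
  shows "A ** matrix_inv A = mat 1" "matrix_inv A ** A = mat 1"
  using someI_ex[OF assms[unfolded invertible_def]] by (simp_all add: matrix_inv_def)

lemma matrix_inv_mult_vec:
  fixes A :: "real^'n^'n"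
  assumes "invertible A"
  shows "A *v (matrix_inv A *v v) = v" "matrix_inv A *v (A *v v) = v"
  by (simp_all add: matrix_vector_mul_assoc matrix_inv_mult[OF assms])

text \<open>No eigenvalues are involved: with w = A^-1 v, Cauchy-Schwarz for the form of
  \<open>A\<close> bounds |v|^4 by the product of v . A v and w . A w = w . v, and the second factor
  is at most C |v|^2. This turns the bound on inverses into coercivity.\<close>

lemma sym_pos_def_coercive:
  assumes A: "sym_pos_def A" and inv: "induced_norm (matrix_inv A) \<le> C"
  shows "(norm v)\<^sup>2 \<le> C * (v \<bullet> (A *v v))"
proof (cases "v = 0")
  case False
  define w where "w = matrix_inv A *v v"
  have Aw: "A *v w = v"
    unfolding w_def by (meson A matrix_inv_mult_vec(1) positive_imp_invertible sym_pos_defD(2))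
  have vAv: "0 < v \<bullet> (A *v v)"
    using A False by (rule sym_pos_defD)
  have "((norm v)\<^sup>2)\<^sup>2 = (v \<bullet> (A *v w))\<^sup>2"
    by (simp add: Aw power2_norm_eq_inner)
  also have "\<dots> \<le> (v \<bullet> (A *v v)) * (w \<bullet> (A *v w))"
    by (intro positive_matrix_Cauchy_Schwarz sym_pos_defD[OF A] vAv)
  also have "w \<bullet> (A *v w) \<le> norm w * norm v"
    by (simp add: Aw norm_cauchy_schwarz)
  also have "norm w \<le> C * norm v"
    using norm_mult_vec_le_induced_norm[of "matrix_inv A" v] inv
    by (metis w_def mult_right_mono norm_ge_zero order_trans)
  finally have "((norm v)\<^sup>2)\<^sup>2 \<le> (v \<bullet> (A *v v)) * (C * norm v * norm v)"
    using vAv by (simp add: mult_left_mono mult_right_mono)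
  then have "(norm v)\<^sup>2 * (norm v)\<^sup>2 \<le> (norm v)\<^sup>2 * (C * (v \<bullet> (A *v v)))"
    by (simp add: power2_eq_square mult_ac)
  then show ?thesis
    by (rule mult_left_le_imp_le) (use False in simp)
qed simp

section \<open>Positive definiteness and sensitivity of the BFGS update\<close>

lemma bfgs_update_eq:
  assumes "transpose B = B"
  shows "bfgs_update B s y = B + (1 / (y \<bullet> s)) *\<^sub>R outer_prod y y
           - (1 / (s \<bullet> (B *v s))) *\<^sub>R outer_prod (B *v s) (B *v s)"
  using assms by (simp add: bfgs_update_def matrix_mult_outer_prod outer_prod_mult_matrix)

text \<open>Write v = c s + w with \<open>w\<close> \<open>B\<close>-orthogonal to \<open>s\<close>.
  The subtracted rank-one term removes exactly the contribution of c s, leaving w . B w + (y . v)^2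
  / (y . s). If w = 0, then \<open>v\<close> is a nonzero multiple of \<open>s\<close> and the
  second term is positive.\<close>

lemma sym_pos_def_bfgs_update:
  assumes B: "sym_pos_def B" and ys: "0 < y \<bullet> s"
  shows "sym_pos_def (bfgs_update B s y)"
proof -
  have s0: "s \<noteq> 0" using ys by auto
  have sym: "transpose B = B"
    using B by (simp add: sym_pos_def_def)
  define \<beta> where "\<beta> = s \<bullet> (B *v s)"
  have \<beta>: "0 < \<beta>"
    unfolding \<beta>_def using B s0 by (rule sym_pos_defD)
  have tr: "transpose (bfgs_update B s y) = bfgs_update B s y"
  proof (rule symmetric_matrixI)
    show "u \<bullet> (bfgs_update B s y *v v) = v \<bullet> (bfgs_update B s y *v u)" for u v
      using sym_pos_defD(1)[OF B]
      by (simp add: bfgs_update_eq[OF sym] algebra_simps scaleR_matrix_vector_assoc[symmetric]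
          outer_prod_mult_vec inner_add_right inner_diff_right inner_commute)
  qed
  have "0 < v \<bullet> (bfgs_update B s y *v v)" if "v \<noteq> 0" for v
  proof -
    define c where "c = (s \<bullet> (B *v v)) / \<beta>"
    define w where "w = v - c *\<^sub>R s"
    have "v \<bullet> (bfgs_update B s y *v v) = v \<bullet> (B *v v) + (y \<bullet> v)\<^sup>2 / (y \<bullet> s) - (s \<bullet> (B *v v))\<^sup>2 / \<beta>"
      using sym_pos_defD(1)[OF B, of v s]
      by (simp add: bfgs_update_eq[OF sym] algebra_simps scaleR_matrix_vector_assoc[symmetric]
          outer_prod_mult_vec inner_add_right inner_diff_right inner_commute \<beta>_def power2_eq_square)
    moreover have "w \<bullet> (B *v w) = v \<bullet> (B *v v) - 2 * c * (s \<bullet> (B *v v)) + c\<^sup>2 * \<beta>"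
      by (simp add: w_def algebra_simps inner_diff_left inner_diff_right power2_eq_square
          sym_pos_defD(1)[OF B, of v s] \<beta>_def)
    then have "w \<bullet> (B *v w) = v \<bullet> (B *v v) - (s \<bullet> (B *v v))\<^sup>2 / \<beta>"
      using \<beta> by (simp add: c_def field_simps power2_eq_square)
    ultimately have eq: "v \<bullet> (bfgs_update B s y *v v) = w \<bullet> (B *v w) + (y \<bullet> v)\<^sup>2 / (y \<bullet> s)"
      by simp
    show ?thesis
    proof (cases "w = 0")
      case True
      then have "v = c *\<^sub>R s" by (simp add: w_def)
      then have "y \<bullet> v \<noteq> 0" using that ys by auto
      then show ?thesis using eq ys True by simp
    next
      case False
      then show ?thesis
        using eq ys sym_pos_defD(2)[OF B False] by (simp add: add_pos_nonneg)
    qed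
  qed
  with tr show ?thesis by (simp add: sym_pos_def_def)
qed

text \<open>The map from \<open>u\<close> to u u^T / (u . s) is Lipschitz at scale |s|. It serves
  twice: with \<open>y\<close> against H s it compares a step with the exact secant step, and with
  \<open>y\<close> against B s it measures how far one update moves \<open>B\<close>.\<close>

lemma rank_one_quotient_diff:
  fixes u v s :: "real^'n"
  assumes s: "s \<noteq> 0" and m: "0 < m" and C: "0 \<le> C"
    and us: "m * (norm s)\<^sup>2 \<le> u \<bullet> s" and vs: "m * (norm s)\<^sup>2 \<le> v \<bullet> s"
    and u: "norm u \<le> C * norm s" and v: "norm v \<le> C * norm s"
  shows "norm ((1 / (u \<bullet> s)) *\<^sub>R outer_prod u u - (1 / (v \<bullet> s)) *\<^sub>R outer_prod v v)
      \<le> (2 * C / m + (C / m)\<^sup>2) * (norm (u - v) / norm s)"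
proof -
  define \<sigma> where "\<sigma> = norm s"
  define \<delta> where "\<delta> = norm (u - v)"
  have \<sigma>: "0 < \<sigma>" using s by (simp add: \<sigma>_def)
  have a: "0 < u \<bullet> s" "0 < v \<bullet> s"
    using us vs m s by (smt (verit) mult_pos_pos zero_less_norm_iff zero_less_power)+
  have inv: "1 / (u \<bullet> s) \<le> 1 / (m * \<sigma>\<^sup>2)" "1 / (v \<bullet> s) \<le> 1 / (m * \<sigma>\<^sup>2)"
    using us vs m \<sigma> a by (auto simp: \<sigma>_def intro!: divide_left_mono)
  \<comment> \<open>The left factor, the right factor and the denominator are exchanged one after
    the other.\<close>
  have "(1 / (u \<bullet> s)) *\<^sub>R outer_prod u u - (1 / (v \<bullet> s)) *\<^sub>R outer_prod v v
     = (1 / (u \<bullet> s)) *\<^sub>R outer_prod (u - v) u + (1 / (u \<bullet> s)) *\<^sub>R outer_prod v (u - v)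
       - ((1 / (u \<bullet> s)) * (1 / (v \<bullet> s)) * ((u - v) \<bullet> s)) *\<^sub>R outer_prod v v"
    using a by (simp add: vec_eq_iff outer_prod_def inner_diff_left field_simps)
  also have "norm \<dots> \<le> norm ((1 / (u \<bullet> s)) *\<^sub>R outer_prod (u - v) u)
      + norm ((1 / (u \<bullet> s)) *\<^sub>R outer_prod v (u - v))
      + norm (((1 / (u \<bullet> s)) * (1 / (v \<bullet> s)) * ((u - v) \<bullet> s)) *\<^sub>R outer_prod v v)"
    by (meson add_mono norm_triangle_ineq norm_triangle_ineq4 order_refl order_trans)
  also have "\<dots> = 1 / (u \<bullet> s) * (\<delta> * norm u) + 1 / (u \<bullet> s) * (norm v * \<delta>)
      + 1 / (u \<bullet> s) * (1 / (v \<bullet> s)) * \<bar>(u - v) \<bullet> s\<bar> * (norm v * norm v)"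
    using a by (simp add: norm_outer_prod \<delta>_def abs_mult)
  also have "\<dots> \<le> 1 / (m * \<sigma>\<^sup>2) * (\<delta> * (C * \<sigma>)) + 1 / (m * \<sigma>\<^sup>2) * ((C * \<sigma>) * \<delta>)
      + 1 / (m * \<sigma>\<^sup>2) * (1 / (m * \<sigma>\<^sup>2)) * (\<delta> * \<sigma>) * ((C * \<sigma>) * (C * \<sigma>))"
    using a inv u v C m \<sigma> Cauchy_Schwarz_ineq2[of "u - v" s]
    unfolding \<sigma>_def[symmetric] \<delta>_def[symmetric]
    by (intro add_mono mult_mono mult_nonneg_nonneg) (auto simp: \<delta>_def)
  also have "\<dots> = (2 * C / m + (C / m)\<^sup>2) * (\<delta> / \<sigma>)"
    using m \<sigma> by (simp add: field_simps power2_eq_square)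
  finally show ?thesis by (simp add: \<delta>_def \<sigma>_def)
qed

section \<open>The Dennis--More condition\<close>

text \<open>Writing \<open>P = H\<^sup>-\<^sup>1\<close>, the potential \<open>trace ((P ** B - 1)\<^sup>2)\<close> is the square of the weighted
  Frobenius distance of \<open>B\<close> from \<open>H\<close>, expressed without the square root of \<open>H\<close>.\<close>

lemma bfgs_update_potential_decrease:
  fixes H P B :: "real^'n^'n" and s :: "real^'n"
  assumes HP: "H ** P = mat 1" and PH: "P ** H = mat 1"
    and Hsym: "transpose H = H" and Bsym: "transpose B = B"
    and Hs: "s \<bullet> (H *v s) \<noteq> 0" and Bs: "s \<bullet> (B *v s) \<noteq> 0"
  defines "W \<equiv> \<lambda>X::real^'n^'n. trace ((X - mat 1) ** (X - mat 1))"
    and "\<theta> \<equiv> ((B *v s) \<bullet> (P *v (B *v s))) / (s \<bullet> (B *v s))"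
  defines "w \<equiv> P *v (B *v s) - \<theta> *\<^sub>R s"
  shows "W (P ** bfgs_update B s (H *v s))
     = W (P ** B) - (2 * (w \<bullet> (B *v w)) / (s \<bullet> (B *v s)) + (\<theta> - 1)\<^sup>2)"
proof -
  interpret T: bounded_bilinear "\<lambda>X Y :: real^'n^'n. trace (X ** Y)"
    using bilinear_trace_mult bilinear_conv_bounded_bilinear by blast
  define b where "b = B *v s"
  define y where "y = H *v s"
  define \<beta> where "\<beta> = s \<bullet> b"
  define \<gamma> where "\<gamma> = s \<bullet> y"
  \<comment> \<open>This is the change of \<open>P ** B\<close> under the update; since
    \<open>P *v y = s\<close>, its first term is a projection onto \<open>s\<close>. As
    \<open>W\<close> is quadratic, it changes by 2 tr((P B - 1) D) + tr(D D), and the terms in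
    \<beta> / \<gamma> of the two traces cancel.\<close>
  define D where "D = (1 / \<gamma>) *\<^sub>R outer_prod s y - (1 / \<beta>) *\<^sub>R outer_prod (P *v b) b"
  have nz: "\<beta> \<noteq> 0" "\<gamma> \<noteq> 0"
    using Hs Bs by (simp_all add: \<beta>_def \<gamma>_def b_def y_def)
  have Py: "P *v y = s"
    by (simp add: y_def matrix_vector_mul_assoc PH)
  have HPv: "H *v (P *v v) = v" for v
    by (simp add: matrix_vector_mul_assoc HP)
  have Bi: "u \<bullet> (B *v v) = v \<bullet> (B *v u)" and Hi: "u \<bullet> (H *v v) = v \<bullet> (H *v u)" for u v
    using symmetric_matrix_inner[OF Bsym] symmetric_matrix_inner[OF Hsym] by blast+
  have yPb: "y \<bullet> (P *v v) = s \<bullet> v" for v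
    using Hi[of "P *v v" s] by (simp add: y_def HPv inner_commute)
  have upd: "P ** bfgs_update B s (H *v s) = P ** B + D"
    using HP PH
    by (simp add: bfgs_update_eq[OF Bsym] D_def matrix_eq Py[unfolded y_def]
        matrix_vector_mul_assoc[symmetric] matrix_vector_right_distrib matrix_vector_mult_diff_distrib
        matrix_vector_mult_add_rdistrib matrix_vector_mult_diff_rdistrib
        scaleR_matrix_vector_assoc[symmetric] outer_prod_mult_vec matrix_vector_mult_scaleR
        b_def y_def \<beta>_def \<gamma>_def inner_commute)
  have TXD: "trace ((P ** B - mat 1) ** D)
      = (1 / \<gamma>) * (\<beta> - \<gamma>) - (1 / \<beta>) * (b \<bullet> (P *v (B *v (P *v b))) - b \<bullet> (P *v b))"
    using yPb[of b]
    by (simp add: D_def T.diff_right T.scaleR_right trace_mult_outer_prod matrix_vector_mult_diff_rdistrib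
        matrix_vector_mul_assoc[symmetric] inner_diff_right b_def[symmetric] yPb inner_commute[of y s]
        \<gamma>_def[symmetric] \<beta>_def[symmetric])
  have TDD: "trace (D ** D) = 1 + (b \<bullet> (P *v b))\<^sup>2 / \<beta>\<^sup>2 - 2 * \<beta> / \<gamma>"
  proof -
    have Dv: "D *v v = ((y \<bullet> v) / \<gamma>) *\<^sub>R s - ((b \<bullet> v) / \<beta>) *\<^sub>R (P *v b)" for v
      by (simp add: D_def matrix_vector_mult_diff_rdistrib scaleR_matrix_vector_assoc[symmetric]
          outer_prod_mult_vec)
    have "trace (D ** D) = (1 / \<gamma>) * (y \<bullet> (D *v s)) - (1 / \<beta>) * (b \<bullet> (D *v (P *v b)))"
      by (subst (2) D_def) (simp only: T.diff_right T.scaleR_right trace_mult_outer_prod real_scaleR_def)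
    also have "y \<bullet> (D *v s) = \<gamma> - \<beta>"
      using nz yPb[of b]
      by (simp add: Dv inner_diff_right inner_commute[of y s] inner_commute[of b s]
          \<gamma>_def[symmetric] \<beta>_def[symmetric])
    also have "b \<bullet> (D *v (P *v b)) = \<beta> * \<beta> / \<gamma> - (b \<bullet> (P *v b)) * (b \<bullet> (P *v b)) / \<beta>"
      using yPb[of b] by (simp add: Dv inner_diff_right inner_commute[of b s] \<beta>_def[symmetric])
    finally show ?thesis
      using nz by (simp add: diff_divide_distrib power2_eq_square)
  qed
  have W: "W (P ** B + D) = W (P ** B) + 2 * trace ((P ** B - mat 1) ** D) + trace (D ** D)"
    by (simp add: W_def T.add_left T.add_right T.diff_left T.diff_right trace_mul_sym[of D "P ** B"]
        trace_add trace_sub)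
  have lam: "\<theta> = (b \<bullet> (P *v b)) / \<beta>"
    by (simp add: \<theta>_def b_def \<beta>_def)
  have "(P *v b) \<bullet> (B *v (P *v b)) = b \<bullet> (P *v (B *v (P *v b)))"
  proof -
    have "b \<bullet> (P *v v) = (P *v b) \<bullet> v" for v
      using Hi[of "P *v b" "P *v v"] by (simp add: HPv inner_commute)
    then show ?thesis by simp
  qed
  moreover have "(P *v b) \<bullet> (B *v s) = \<theta> * \<beta>"
    using nz by (simp add: lam b_def[symmetric] inner_commute)
  \<comment> \<open>The scalar \<theta> is the one for which \<open>w\<close> is
    \<open>B\<close>-orthogonal to \<open>s\<close>, so this is Pythagoras for the form of
    \<open>B\<close>.\<close>
  ultimately have "w \<bullet> (B *v w) = b \<bullet> (P *v (B *v (P *v b))) - \<theta>\<^sup>2 * \<beta>"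
    using Bi[of s "P *v b"]
    by (simp add: w_def b_def[symmetric] matrix_vector_mult_diff_distrib matrix_vector_mult_scaleR
        inner_diff_left inner_diff_right \<beta>_def[symmetric] power2_eq_square)
  then have "b \<bullet> (P *v (B *v (P *v b))) = w \<bullet> (B *v w) + \<theta>\<^sup>2 * \<beta>"
    by simp
  then have "trace ((P ** B - mat 1) ** D) = \<beta> / \<gamma> - 1 - w \<bullet> (B *v w) / \<beta> - \<theta>\<^sup>2 + \<theta>"
    using nz unfolding TXD by (simp add: lam diff_divide_distrib add_divide_distrib)
  moreover have "trace (D ** D) = 1 + \<theta>\<^sup>2 - 2 * \<beta> / \<gamma>"
    unfolding TDD by (simp add: lam power_divide)
  ultimately show ?thesis
    unfolding upd W b_def[symmetric] \<beta>_def[symmetric] by (simp add: power2_diff)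
qed

lemma bfgs_Dennis_More:
  fixes H :: "real^'n^'n" and B :: "nat \<Rightarrow> real^'n^'n" and s y :: "nat \<Rightarrow> real^'n"
  assumes m: "0 < m"
    and Hsym: "transpose H = H" and H: "\<And>v. m * (norm v)\<^sup>2 \<le> v \<bullet> (H *v v)"
    and Bsym: "\<And>t. transpose (B t) = B t" and B: "\<And>t v. m * (norm v)\<^sup>2 \<le> v \<bullet> (B t *v v)"
    and Bbound: "\<And>t. norm (B t) \<le> C"
    and step: "\<And>t. B (Suc t) = (if s t = 0 then B t else bfgs_update (B t) (s t) (y t))"
    and ys: "\<And>t. m * (norm (s t))\<^sup>2 \<le> y t \<bullet> s t"
    and sec: "\<And>t. norm (y t - H *v s t) \<le> \<sigma> t * norm (s t)"
    and \<sigma>: "\<And>t. 0 \<le> \<sigma> t" "summable \<sigma>"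
  obtains q where "q \<longlonglongrightarrow> 0" "\<And>t. 0 \<le> q t"
    "\<And>t. norm ((B t - H) *v s t) \<le> q t * norm (s t)"
    "\<And>t. norm (B (Suc t) - B t) \<le> q t"
proof -
  define P where "P = matrix_inv H"
  have "invertible H"
    by (rule positive_imp_invertible, rule less_le_trans[OF _ H]) (use m in simp)
  then have HP: "H ** P = mat 1" "P ** H = mat 1"
    by (simp_all add: P_def matrix_inv_mult)
  have HPv: "H *v (P *v v) = v" for v
    by (simp add: matrix_vector_mul_assoc HP)
  define S where "S = suminf \<sigma>"
  have S: "\<sigma> t \<le> S" for t
    using sum_le_suminf[OF \<sigma>(2), of "{t}"] \<sigma>(1) by (simp add: S_def)
  have S0: "0 \<le> S" by (rule order_trans[OF \<sigma>(1)[of 0] S])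
  have C0: "0 \<le> C" by (rule order_trans[OF norm_ge_zero Bbound])
  define C1 where "C1 = C + norm H + S"
  have C1: "0 \<le> C1" by (simp add: C1_def C0 S0)
  have hb: "norm (H *v s t) \<le> C1 * norm (s t)" for t
    by (rule order_trans[OF norm_mult_vec_le]) (simp add: C1_def C0 S0 mult_right_mono)
  have bb: "norm (B t *v s t) \<le> C1 * norm (s t)" for t
    by (rule order_trans[OF norm_mult_vec_le], intro mult_right_mono)
       (use Bbound[of t] S0 norm_ge_zero[of H] in \<open>unfold C1_def, linarith, simp\<close>)
  have yb: "norm (y t) \<le> C1 * norm (s t)" for t
  proof -
    have "norm (y t) \<le> norm (H *v s t) + norm (y t - H *v s t)"
      by (metis add.commute norm_triangle_sub)
    also have "\<dots> \<le> norm H * norm (s t) + S * norm (s t)"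
      by (intro add_mono norm_mult_vec_le order_trans[OF sec] mult_right_mono S) auto
    also have "\<dots> \<le> C1 * norm (s t)"
      by (simp add: C1_def C0 algebra_simps)
    finally show ?thesis .
  qed
  have hs: "m * (norm (s t))\<^sup>2 \<le> (H *v s t) \<bullet> s t" and bs: "m * (norm (s t))\<^sup>2 \<le> (B t *v s t) \<bullet> s t" for t
    using H[of "s t"] B[of "s t" t] by (simp_all add: inner_commute)
  define K1 where "K1 = 2 * C1 / m + (C1 / m)\<^sup>2"
  have K1: "0 \<le> K1" using m C1 by (simp add: K1_def)
  interpret T: bounded_bilinear "\<lambda>X Y :: real^'n^'n. trace (X ** Y)"
    using bilinear_trace_mult bilinear_conv_bounded_bilinear by blast
  interpret M: bounded_bilinear "(**) :: real^'n^'n \<Rightarrow> real^'n^'n \<Rightarrow> real^'n^'n"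
    by (rule bounded_bilinear_matrix_mult)
  obtain KT where KT: "0 < KT" "\<And>X Y. norm (trace ((X :: real^'n^'n) ** Y)) \<le> norm X * norm Y * KT"
    using T.pos_bounded by blast
  obtain KM where KM: "0 < KM" "\<And>X Y. norm ((X :: real^'n^'n) ** (Y :: real^'n^'n)) \<le> norm X * norm Y * KM"
    using M.pos_bounded by blast
  define W where "W = (\<lambda>X::real^'n^'n. trace ((X - mat 1) ** (X - mat 1)))"
  define V where "V t = W (P ** B t)" for t
  define \<theta> where "\<theta> t = ((B t *v s t) \<bullet> (P *v (B t *v s t))) / (s t \<bullet> (B t *v s t))" for t
  define w where "w t = P *v (B t *v s t) - \<theta> t *\<^sub>R s t" for t
  define d where "d t = (if s t = 0 then 0 else
      2 * (w t \<bullet> (B t *v w t)) / (s t \<bullet> (B t *v s t)) + (\<theta> t - 1)\<^sup>2)" for t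
  have pos: "0 < s t \<bullet> (B t *v s t)" "0 < s t \<bullet> (H *v s t)" if "s t \<noteq> 0" for t
  proof -
    have "0 < m * (norm (s t))\<^sup>2" using that m by simp
    then show "0 < s t \<bullet> (B t *v s t)" "0 < s t \<bullet> (H *v s t)"
      using H[of "s t"] B[of "s t" t] by linarith+
  qed
  have wBw: "0 \<le> w t \<bullet> (B t *v w t)" for t
    by (rule order_trans[OF _ B]) (use m in simp)
  have d0: "0 \<le> d t" for t
    using pos(1)[of t] wBw[of t] by (auto simp: d_def)
  define C2 where "C2 = norm P * C * KM + norm (mat 1 :: real^'n^'n)"
  have X: "norm (P ** B t - mat 1) \<le> C2" for t
  proof -
    have "norm (P ** B t - mat 1) \<le> norm (P ** B t) + norm (mat 1 :: real^'n^'n)"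
      by (rule norm_triangle_ineq4)
    also have "norm (P ** B t) \<le> norm P * C * KM"
      by (rule order_trans[OF KM(2)]) (use KM(1) Bbound in \<open>simp add: mult_left_mono mult_right_mono\<close>)
    finally show ?thesis by (simp add: C2_def)
  qed
  have C2: "0 \<le> C2" by (rule order_trans[OF norm_ge_zero X])
  define K2 where "K2 = norm P * K1 * KM"
  have K2: "0 \<le> K2" using K1 KM(1) by (simp add: K2_def)
  define K3 where "K3 = (2 * C2 + K2 * S) * KT * K2"
  have K3: "0 \<le> K3" using C2 K2 S0 KT(1) by (simp add: K3_def)
  have V_step: "V (Suc t) \<le> V t - d t + K3 * \<sigma> t" for t
  proof (cases "s t = 0")
    case True
    then show ?thesis
      using step[of t] K3 \<sigma>(1)[of t] by (simp add: V_def d_def)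
  next
    case False
    \<comment> \<open>The actual update minus the one with the exact secant vector H s. The terms in
      \<open>B t\<close> cancel, so only a difference of two rank-one quotients remains.\<close>
    define \<Delta> where "\<Delta> = B (Suc t) - bfgs_update (B t) (s t) (H *v s t)"
    define Y where "Y = P ** \<Delta>"
    have "\<Delta> = (1 / (y t \<bullet> s t)) *\<^sub>R outer_prod (y t) (y t)
        - (1 / ((H *v s t) \<bullet> s t)) *\<^sub>R outer_prod (H *v s t) (H *v s t)"
      using False by (simp add: \<Delta>_def step bfgs_update_def)
    then have "norm \<Delta> \<le> K1 * (norm (y t - H *v s t) / norm (s t))"
      unfolding K1_def using rank_one_quotient_diff[OF False m C1 ys hs yb hb] by simp
    also have "\<dots> \<le> K1 * \<sigma> t"
      using sec[of t] False K1 by (intro mult_left_mono) (auto simp: divide_le_eq)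
    finally have \<Delta>: "norm \<Delta> \<le> K1 * \<sigma> t" .
    have Y: "norm Y \<le> K2 * \<sigma> t"
    proof -
      have "norm Y \<le> norm P * norm \<Delta> * KM" unfolding Y_def by (rule KM(2))
      also have "\<dots> \<le> norm P * (K1 * \<sigma> t) * KM"
        using \<Delta> KM(1) by (simp add: mult_left_mono mult_right_mono)
      finally show ?thesis by (simp add: K2_def mult_ac)
    qed
    \<comment> \<open>The quadratic \<open>W\<close> is expanded around the new matrix, whose
      distance from the identity is bounded by \<open>C2\<close>; hence the minus sign before the
      last trace.\<close>
    have "W (P ** B (Suc t)) = W (P ** B (Suc t) - Y) + 2 * trace ((P ** B (Suc t) - mat 1) ** Y) - trace (Y ** Y)"
      by (simp add: W_def T.diff_left T.diff_right trace_mul_sym[of Y "P ** B (Suc t)"]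
          trace_add trace_sub)
    moreover have "P ** B (Suc t) - Y = P ** bfgs_update (B t) (s t) (H *v s t)"
      by (simp add: Y_def \<Delta>_def M.diff_right)
    moreover have "W (P ** bfgs_update (B t) (s t) (H *v s t)) = V t - d t"
      using bfgs_update_potential_decrease[OF HP Hsym Bsym[of t], of "s t"] pos[OF False] False
      by (simp add: W_def V_def d_def w_def \<theta>_def)
    moreover have "2 * trace ((P ** B (Suc t) - mat 1) ** Y) - trace (Y ** Y) \<le> K3 * \<sigma> t"
    proof -
      have YS: "norm Y \<le> K2 * S"
        using Y S[of t] K2 by (meson mult_left_mono order_trans)
      have "2 * trace ((P ** B (Suc t) - mat 1) ** Y) - trace (Y ** Y)
          \<le> 2 * norm (trace ((P ** B (Suc t) - mat 1) ** Y)) + norm (trace (Y ** Y))"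
        by simp
      also have "\<dots> \<le> 2 * (norm (P ** B (Suc t) - mat 1) * norm Y * KT) + norm Y * norm Y * KT"
        by (intro add_mono mult_left_mono KT(2)) auto
      also have "\<dots> = (2 * norm (P ** B (Suc t) - mat 1) + norm Y) * KT * norm Y"
        by (simp add: algebra_simps)
      also have "\<dots> \<le> (2 * C2 + K2 * S) * KT * (K2 * \<sigma> t)"
        using X[of "Suc t"] YS Y KT(1) C2 K2 S0
        by (intro mult_mono add_mono mult_left_mono mult_nonneg_nonneg add_nonneg_nonneg) auto
      finally show ?thesis by (simp add: K3_def mult_ac)
    qed
    ultimately show ?thesis by (simp add: V_def)
  qed
  \<comment> \<open>Any lower bound makes the decreases summable. This one needs only the bound on
    \<open>B\<close>, without exhibiting the potential as a square.\<close>
  have V_lower: "- (C2 * C2 * KT) \<le> V t" for t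
  proof -
    have "\<bar>V t\<bar> \<le> norm (P ** B t - mat 1) * norm (P ** B t - mat 1) * KT"
      using KT(2) by (simp add: V_def W_def)
    also have "\<dots> \<le> C2 * C2 * KT"
      using X[of t] KT(1) C2 by (intro mult_mono) auto
    finally show ?thesis by simp
  qed
  have "sum d {..<N} \<le> V 0 + C2 * C2 * KT + K3 * S" for N
  proof -
    have "sum d {..<N} \<le> V 0 - V N + K3 * sum \<sigma> {..<N}"
    proof (induction N)
      case (Suc N)
      then show ?case using V_step[of N] by (simp add: distrib_left)
    qed simp
    also have "sum \<sigma> {..<N} \<le> S"
      unfolding S_def by (rule sum_le_suminf) (use \<sigma> in auto)
    finally show ?thesis using V_lower[of N] K3 by (simp add: mult_left_mono)
  qed
  then have "sum d {..N} \<le> V 0 + C2 * C2 * KT + K3 * S" for N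
    unfolding lessThan_Suc_atMost[symmetric] .
  then have "summable d"
    by (rule bounded_imp_summable[OF d0])
  then have d_lim: "d \<longlonglongrightarrow> 0" by (rule summable_LIMSEQ_zero)
  define K4 where "K4 = C1 / m + 2"
  define q1 where "q1 t = norm H * sqrt (K4 * d t)" for t
  have K4: "0 \<le> K4" using C1 m by (simp add: K4_def)
  have q1_0: "0 \<le> q1 t" for t using K4 d0 by (simp add: q1_def)
  have q1_lim: "q1 \<longlonglongrightarrow> 0"
    unfolding q1_def by (rule tendsto_eq_intros d_lim refl | simp)+
  have q1: "norm ((B t - H) *v s t) \<le> q1 t * norm (s t)" for t
  proof (cases "s t = 0")
    case False
    \<comment> \<open>Here v = P B s - s. Its summands \<open>w\<close> and (\<theta> - 1) s are
      each controlled by one of the two terms of \<open>d\<close>: the first with factor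
      \<open>C1 / m\<close>, through coercivity of \<open>B\<close> and an upper bound on s . B s,
      the second with factor 2. This is the origin of \<open>K4\<close>.\<close>
    define v where "v = w t + (\<theta> t - 1) *\<^sub>R s t"
    define \<beta> where "\<beta> = s t \<bullet> (B t *v s t)"
    have \<beta>: "0 < \<beta>" using pos[OF False] by (simp add: \<beta>_def)
    have Hv: "H *v v = (B t - H) *v s t"
      by (simp add: v_def w_def algebra_simps HPv)
    have "\<beta> \<le> C1 * (norm (s t))\<^sup>2"
    proof -
      have "\<beta> \<le> norm (s t) * norm (B t *v s t)" by (simp add: \<beta>_def norm_cauchy_schwarz)
      also have "\<dots> \<le> norm (s t) * (C1 * norm (s t))" using bb by (simp add: mult_left_mono)
      finally show ?thesis by (simp add: power2_eq_square mult_ac)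
    qed
    moreover have "m * (norm (w t))\<^sup>2 \<le> w t \<bullet> (B t *v w t)" by (rule B)
    ultimately have "m * (norm (w t))\<^sup>2 * \<beta> \<le> (w t \<bullet> (B t *v w t)) * (C1 * (norm (s t))\<^sup>2)"
      using \<beta> wBw[of t] by (intro mult_mono) auto
    then have wn: "2 * (norm (w t))\<^sup>2 \<le> C1 / m * (norm (s t))\<^sup>2 * (2 * (w t \<bullet> (B t *v w t)) / \<beta>)"
      using \<beta> m by (simp add: field_simps)
    have "(norm v)\<^sup>2 \<le> 2 * (norm (w t))\<^sup>2 + 2 * (norm ((\<theta> t - 1) *\<^sub>R s t))\<^sup>2"
    proof -
      have "(norm v)\<^sup>2 \<le> (norm (w t) + norm ((\<theta> t - 1) *\<^sub>R s t))\<^sup>2"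
        unfolding v_def by (intro power_mono norm_triangle_ineq norm_ge_zero)
      then show ?thesis
        using sum_squares_bound[of "norm (w t)" "norm ((\<theta> t - 1) *\<^sub>R s t)"]
        by (simp add: power2_sum)
    qed
    also have "\<dots> = 2 * (norm (w t))\<^sup>2 + 2 * (norm (s t))\<^sup>2 * (\<theta> t - 1)\<^sup>2"
      by (simp add: power_mult_distrib)
    also have "\<dots> \<le> C1 / m * (norm (s t))\<^sup>2 * d t + 2 * (norm (s t))\<^sup>2 * d t"
    proof (rule add_mono)
      have "2 * (w t \<bullet> (B t *v w t)) / \<beta> \<le> d t" using False by (simp add: d_def \<beta>_def)
      then have "C1 / m * (norm (s t))\<^sup>2 * (2 * (w t \<bullet> (B t *v w t)) / \<beta>) \<le> C1 / m * (norm (s t))\<^sup>2 * d t"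
        using C1 m by (intro mult_left_mono) auto
      with wn show "2 * (norm (w t))\<^sup>2 \<le> C1 / m * (norm (s t))\<^sup>2 * d t" by linarith
      have "(\<theta> t - 1)\<^sup>2 \<le> d t" using False wBw[of t] \<beta> by (simp add: d_def \<beta>_def)
      then show "2 * (norm (s t))\<^sup>2 * (\<theta> t - 1)\<^sup>2 \<le> 2 * (norm (s t))\<^sup>2 * d t"
        by (intro mult_left_mono) auto
    qed
    also have "\<dots> = K4 * d t * (norm (s t))\<^sup>2" by (simp add: K4_def algebra_simps)
    finally have "sqrt ((norm v)\<^sup>2) \<le> sqrt (K4 * d t * (norm (s t))\<^sup>2)"
      by (rule real_sqrt_le_mono)
    then have "norm v \<le> sqrt (K4 * d t) * norm (s t)"
      by (simp add: real_sqrt_mult)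
    then have "norm H * norm v \<le> q1 t * norm (s t)"
      by (simp add: q1_def mult.assoc mult_left_mono)
    then show ?thesis
      using norm_mult_vec_le[of H v] by (simp add: Hv)
  qed simp
  \<comment> \<open>One sequence for both conclusions. The second summand bounds the change of
    \<open>B\<close>, because y - B s = (y - H s) - (B - H) s.\<close>
  define q where "q t = q1 t + K1 * (\<sigma> t + q1 t)" for t
  have q_ge: "q1 t \<le> q t" for t
    using q1_0[of t] \<sigma>(1)[of t] K1 by (simp add: q_def)
  show thesis
  proof
    show "q \<longlonglongrightarrow> 0"
      unfolding q_def by (rule tendsto_eq_intros q1_lim summable_LIMSEQ_zero[OF \<sigma>(2)] refl | simp)+
    show "0 \<le> q t" for t using q_ge[of t] q1_0[of t] by simp
    show "norm ((B t - H) *v s t) \<le> q t * norm (s t)" for t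
      by (rule order_trans[OF q1]) (simp add: q_ge mult_right_mono)
    show "norm (B (Suc t) - B t) \<le> q t" for t
    proof (cases "s t = 0")
      case True
      then show ?thesis using step[of t] q_ge[of t] q1_0[of t] by simp
    next
      case False
      have "B (Suc t) - B t = (1 / (y t \<bullet> s t)) *\<^sub>R outer_prod (y t) (y t)
          - (1 / ((B t *v s t) \<bullet> s t)) *\<^sub>R outer_prod (B t *v s t) (B t *v s t)"
        using False by (simp add: step bfgs_update_eq[OF Bsym] inner_commute)
      then have "norm (B (Suc t) - B t) \<le> K1 * (norm (y t - B t *v s t) / norm (s t))"
        unfolding K1_def using rank_one_quotient_diff[OF False m C1 ys bs yb bb] by simp
      also have "\<dots> \<le> K1 * (\<sigma> t + q1 t)"
      proof (rule mult_left_mono[OF _ K1])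
        have "norm (y t - B t *v s t) = norm ((y t - H *v s t) - (B t - H) *v s t)"
          by (simp add: matrix_vector_mult_diff_rdistrib)
        also have "\<dots> \<le> norm (y t - H *v s t) + norm ((B t - H) *v s t)"
          by (rule norm_triangle_ineq4)
        also have "\<dots> \<le> (\<sigma> t + q1 t) * norm (s t)"
          using sec[of t] q1[of t] by (simp add: algebra_simps)
        finally show "norm (y t - B t *v s t) / norm (s t) \<le> \<sigma> t + q1 t"
          using False by (simp add: divide_le_eq)
      qed
      also have "\<dots> \<le> q t" using q1_0 by (simp add: q_def)
      finally show ?thesis .
    qed
  qed
qed

section \<open>Superlinear majorants\<close>

lemma superlinear_subsequence:
  fixes a :: "nat \<Rightarrow> real"
  assumes lim: "a \<longlonglongrightarrow> 0" and pos: "\<And>N. \<exists>t\<ge>N. 0 < a t"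
  obtains \<phi> where "strict_mono \<phi>" "superlinear_to_zero (\<lambda>k. a (\<phi> k))"
proof -
  have "\<exists>\<phi>. \<forall>k. 0 < a (\<phi> k) \<and> (\<phi> k < \<phi> (Suc k) \<and> a (\<phi> (Suc k)) \<le> a (\<phi> k) / real (Suc k))"
  proof (rule dependent_nat_choice)
    show "\<exists>t. 0 < a t" using pos by blast
    show "\<exists>t'. 0 < a t' \<and> t < t' \<and> a t' \<le> a t / real (Suc k)" if t: "0 < a t" for t k
    proof -
      have "eventually (\<lambda>t'. a t' < a t / real (Suc k)) sequentially"
        using t by (intro order_tendstoD(2)[OF lim]) simp
      then obtain N where N: "\<And>t'. N \<le> t' \<Longrightarrow> a t' < a t / real (Suc k)"
        by (auto simp: eventually_sequentially)
      obtain t' where "max N (Suc t) \<le> t'" "0 < a t'" using pos by blast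
      then show ?thesis using N[of t'] by (intro exI[of _ t']) auto
    qed
  qed
  then obtain \<phi> where \<phi>: "\<And>k. 0 < a (\<phi> k)" "\<And>k. \<phi> k < \<phi> (Suc k)"
    "\<And>k. a (\<phi> (Suc k)) \<le> a (\<phi> k) / real (Suc k)" by blast
  show thesis
  proof
    show mono: "strict_mono \<phi>" using \<phi>(2) by (simp add: strict_mono_Suc_iff)
    have "(\<lambda>k. a (\<phi> (Suc k)) / a (\<phi> k)) \<longlonglongrightarrow> 0"
    proof (rule tendsto_sandwich[OF _ _ tendsto_const LIMSEQ_inverse_real_of_nat])
      show "\<forall>\<^sub>F k in sequentially. 0 \<le> a (\<phi> (Suc k)) / a (\<phi> k)"
        using \<phi>(1) by (simp add: less_imp_le)
      show "\<forall>\<^sub>F k in sequentially. a (\<phi> (Suc k)) / a (\<phi> k) \<le> inverse (real (Suc k))"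
        using \<phi>(1,3) by (intro always_eventually) (simp add: divide_simps mult.commute)
    qed
    moreover have "(\<lambda>k. a (\<phi> k)) \<longlonglongrightarrow> 0"
      using LIMSEQ_subseq_LIMSEQ[OF lim mono] by (simp add: o_def)
    ultimately show "superlinear_to_zero (\<lambda>k. a (\<phi> k))"
      using \<phi>(1) by (simp add: superlinear_to_zero_def)
  qed
qed

text \<open>The geometric mean of \<open>N\<close> consecutive terms turns an \<open>N\<close>-step superlinear rate into a
  one-step superlinear rate, since consecutive means share all but one factor.\<close>

lemma superlinear_majorant:
  fixes S :: "nat \<Rightarrow> real"
  assumes pos: "\<And>t. 0 < S t" and dec: "antimono S" and N: "0 < N"
    and ratio: "(\<lambda>t. S (t + N) / S t) \<longlonglongrightarrow> 0" and lim: "S \<longlonglongrightarrow> 0"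
  obtains \<zeta> where "\<And>t. S t \<le> \<zeta> t" "superlinear_to_zero \<zeta>"
proof -
  \<comment> \<open>For j > t the truncated difference \<open>t - j\<close> is 0, so the missing
    earlier terms are replaced by \<open>S 0\<close>, which is still at least
    \<open>S t\<close>.\<close>
  define \<zeta> where "\<zeta> t = (\<Prod>j<N. root N (S (t - j)))" for t
  have pos\<zeta>: "0 < \<zeta> t" for t
    using pos N by (auto simp: \<zeta>_def intro!: prod_pos)
  have ge: "S t \<le> \<zeta> t" for t
  proof -
    have "S t = (\<Prod>j<N. root N (S t))"
      using N pos[of t] by (simp add: less_imp_le)
    also have "\<dots> \<le> \<zeta> t"
      unfolding \<zeta>_def
      by (intro prod_mono conjI real_root_le_mono N antimonoD[OF dec])
         (use pos N in \<open>auto simp: less_imp_le\<close>)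
    finally show ?thesis .
  qed
  \<comment> \<open>The offset \<open>N\<close> keeps all differences \<open>t + N - j\<close>
    genuine. All factors cancel except the newest of the numerator and the oldest of the
    denominator.\<close>
  have rec: "\<zeta> (t + Suc N) / \<zeta> (t + N) = root N (S (Suc t + N) / S (Suc t))" for t
  proof -
    obtain M where M: "N = Suc M" using N gr0_implies_Suc by blast
    define g where "g j = root N (S (t + N - j))" for j
    have "\<zeta> (t + Suc N) = root N (S (Suc t + N)) * (\<Prod>j<M. g j)"
      unfolding \<zeta>_def M prod.lessThan_Suc_shift by (simp add: g_def M)
    moreover have "\<zeta> (t + N) = (\<Prod>j<M. g j) * root N (S (Suc t))"
      unfolding \<zeta>_def M prod.lessThan_Suc by (simp add: g_def M)
    moreover have "(\<Prod>j<M. g j) \<noteq> 0"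
      using pos N by (simp add: g_def less_imp_neq[symmetric])
    ultimately show ?thesis
      using pos N by (simp add: real_root_divide)
  qed
  have "(\<lambda>t. root N (S (Suc t + N) / S (Suc t))) \<longlonglongrightarrow> root N 0"
    by (intro tendsto_real_root LIMSEQ_Suc[OF ratio])
  then have "(\<lambda>t. \<zeta> (Suc (t + N)) / \<zeta> (t + N)) \<longlonglongrightarrow> 0"
    using rec by simp
  then have rat: "(\<lambda>t. \<zeta> (Suc t) / \<zeta> t) \<longlonglongrightarrow> 0"
    by (rule LIMSEQ_offset[of _ N])
  have "\<zeta> \<longlonglongrightarrow> 0"
  proof (rule LIMSEQ_offset[of _ N])
    have "(\<lambda>t. \<Prod>j<N. root N (S (t + N - j))) \<longlonglongrightarrow> (\<Prod>j<N. root N 0)"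
    proof (intro tendsto_prod tendsto_real_root)
      fix j assume "j \<in> {..<N}"
      then have "(\<lambda>t. S (t + N - j)) = (\<lambda>t. S (t + (N - j)))" by auto
      then show "(\<lambda>t. S (t + N - j)) \<longlonglongrightarrow> 0"
        using LIMSEQ_ignore_initial_segment[OF lim, of "N - j"] by simp
    qed
    then show "(\<lambda>t. \<zeta> (t + N)) \<longlonglongrightarrow> 0"
      using N by (simp add: \<zeta>_def power_0_left)
  qed
  with pos\<zeta> rat have "superlinear_to_zero \<zeta>"
    by (simp add: superlinear_to_zero_def)
  with ge show thesis by (rule that)
qed

text \<open>Partial sums of the derivative of the geometric series. The weight \<open>Suc j\<close>
  will count \<open>j\<close> steps of drift of a slowly varying matrix, plus one Dennis-More
  term.\<close>

lemma sum_Suc_mult_power_le: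
  fixes \<rho> :: real
  assumes "0 \<le> \<rho>" "\<rho> < 1"
  shows "(\<Sum>j<J. real (Suc j) * \<rho> ^ j) \<le> 1 / (1 - \<rho>)\<^sup>2"
proof -
  have "(\<lambda>j. real (Suc j) * \<rho> ^ j) sums (1 / (1 - \<rho>)\<^sup>2)"
    using geometric_deriv_sums[of \<rho>] assms by simp
  then show ?thesis
    using assms sum_le_suminf[OF sums_summable, of "\<lambda>j. real (Suc j) * \<rho> ^ j" _ "{..<J}"]
    by (simp add: sums_unique[symmetric])
qed

text \<open>The forward supremum \<open>S t = sup\<^sub>k \<rho>\<^sup>-\<^sup>k a (t + k)\<close> dominates \<open>a\<close> and decays geometrically, so
  a bound on \<open>a (t + n + 1)\<close> by \<open>\<epsilon> S t\<close>, which may involve future terms of \<open>a\<close>, still yields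
  superlinear decay of \<open>S\<close>.\<close>

lemma superlinear_majorant_forward_sup:
  fixes a :: "nat \<Rightarrow> real"
  assumes \<rho>: "0 < \<rho>" "\<rho> < 1" and nonneg: "\<And>t. 0 \<le> a t" and bound: "\<And>t. a t \<le> A * \<rho> ^ t"
    and pos: "\<And>N. \<exists>t\<ge>N. 0 < a t"
    and step: "\<And>S \<epsilon>. \<lbrakk>\<And>t k. a (t + k) \<le> \<rho> ^ k * S t; 0 < \<epsilon>\<rbrakk> \<Longrightarrow>
        \<exists>T. \<forall>t\<ge>T. a (Suc t + n) \<le> \<epsilon> * S t"
  obtains \<zeta> where "\<And>t. a t \<le> \<zeta> t" "superlinear_to_zero \<zeta>"
proof -
  define S where "S t = (SUP k. a (t + k) / \<rho> ^ k)" for t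
  have A: "0 \<le> A" using order_trans[OF nonneg[of 0] bound[of 0]] by simp
  have le: "a (t + k) / \<rho> ^ k \<le> A * \<rho> ^ t" for t k
    using bound[of "t + k"] \<rho> by (simp add: divide_le_eq power_add mult_ac)
  then have bdd: "bdd_above (range (\<lambda>k. a (t + k) / \<rho> ^ k))" for t
    unfolding bdd_above_def by blast
  have upper: "a (t + k) / \<rho> ^ k \<le> S t" for t k
    unfolding S_def by (rule cSUP_upper[OF UNIV_I bdd])
  have S_le: "S t \<le> c" if "\<And>k. a (t + k) / \<rho> ^ k \<le> c" for t c
    unfolding S_def by (rule cSUP_least) (use that in auto)
  have aS: "a (t + k) \<le> \<rho> ^ k * S t" for t k
    using upper[of t k] \<rho> by (simp add: divide_le_eq mult.commute)
  have S_nonneg: "0 \<le> S t" for t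
    using order_trans[OF nonneg aS[of t 0]] by simp
  have S_add: "S (t + j) \<le> \<rho> ^ j * S t" for t j
  proof (rule S_le)
    show "a (t + j + k) / \<rho> ^ k \<le> \<rho> ^ j * S t" for k
      using aS[of t "j + k"] \<rho> by (simp add: divide_le_eq power_add mult_ac add_ac)
  qed
  have dec: "antimono S"
  proof (rule antimonoI)
    fix t t' :: nat assume "t \<le> t'"
    then have "S t' \<le> \<rho> ^ (t' - t) * S t" using S_add[of t "t' - t"] by simp
    also have "\<dots> \<le> S t"
      using \<rho> S_nonneg by (intro mult_left_le_one_le) (auto intro: power_le_one)
    finally show "S t' \<le> S t" .
  qed
  have S_pos: "0 < S t" for t
  proof -
    obtain t' where t': "t \<le> t'" "0 < a t'" using pos by blast
    then have "0 < \<rho> ^ (t' - t) * S t" using aS[of t "t' - t"] by simp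
    then show ?thesis using \<rho> by (simp add: zero_less_mult_iff)
  qed
  have "S \<longlonglongrightarrow> 0"
  proof (rule tendsto_sandwich[OF _ _ tendsto_const])
    show "(\<lambda>t. A * \<rho> ^ t) \<longlonglongrightarrow> 0"
      using \<rho> by (intro tendsto_mult_right_zero LIMSEQ_power_zero) simp
    show "\<forall>\<^sub>F t in sequentially. S t \<le> A * \<rho> ^ t" using S_le[OF le] by simp
  qed (simp add: S_nonneg)
  moreover have "(\<lambda>t. S (t + Suc n) / S t) \<longlonglongrightarrow> 0"
  proof (rule LIMSEQ_I)
    fix e :: real assume e: "0 < e"
    obtain T where T: "\<And>t. T \<le> t \<Longrightarrow> a (Suc t + n) \<le> e / 2 * S t"
      using step[OF aS, of "e / 2"] e by auto
    have "norm (S (t + Suc n) / S t - 0) < e" if t: "T \<le> t" for t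
    proof -
      \<comment> \<open>The bound on \<open>a\<close> passes to the supremum by using it at every
        \<open>t + k\<close>: the decay of \<open>S (t + k)\<close> supplies the factor
        \<open>\<rho> ^ k\<close> that cancels the weight. The halved \<open>e\<close> leaves room
        for strictness.\<close>
      have "S (t + Suc n) \<le> e / 2 * S t"
      proof (rule S_le)
        fix k
        have "a (t + Suc n + k) \<le> e / 2 * S (t + k)" using T[of "t + k"] t by (simp add: add_ac)
        also have "\<dots> \<le> e / 2 * (\<rho> ^ k * S t)" using e S_add by (intro mult_left_mono) auto
        finally show "a (t + Suc n + k) / \<rho> ^ k \<le> e / 2 * S t"
          using \<rho> by (simp add: divide_le_eq mult_ac)
      qed
      also have "\<dots> < e * S t" using e S_pos by simp
      finally show ?thesis using S_pos[of t] S_nonneg[of "t + Suc n"] by (simp add: divide_less_eq)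
    qed
    then show "\<exists>no. \<forall>t\<ge>no. norm (S (t + Suc n) / S t - 0) < e" by blast
  qed
  ultimately obtain \<zeta> where \<zeta>: "\<And>t. S t \<le> \<zeta> t" "superlinear_to_zero \<zeta>"
    using superlinear_majorant[of S "Suc n"] S_pos dec by blast
  have "a t \<le> \<zeta> t" for t
    using order_trans[OF _ \<zeta>(1)[of t], of "a t"] aS[of t 0] by simp
  with \<zeta>(2) show thesis using that by blast
qed

text \<open>Since \<open>u\<close> tends to zero, \<open>- u t\<close> is the sum of all increments from time \<open>t\<close> on.\<close>

lemma slowly_varying_residual_bound:
  fixes E :: "nat \<Rightarrow> real^'n^'n" and u :: "nat \<Rightarrow> real^'n"
  assumes q: "\<And>j. norm ((E (t + j)) *v (u (Suc (t + j)) - u (t + j))) \<le> q * norm (u (Suc (t + j)) - u (t + j))"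
    and E: "\<And>j. norm (E (Suc (t + j)) - E (t + j)) \<le> q"
    and u: "\<And>j. norm (u (t + j)) \<le> \<rho> ^ j * S" and \<rho>: "0 \<le> \<rho>" "\<rho> < 1"
  shows "norm (E t *v u t) \<le> q * (2 * S / (1 - \<rho>)\<^sup>2)"
proof -
  define s where "s j = u (Suc (t + j)) - u (t + j)" for j
  have q0: "0 \<le> q" using order_trans[OF norm_ge_zero E[of 0]] .
  have S0: "0 \<le> S" using order_trans[OF norm_ge_zero u[of 0]] by simp
  have Ej: "norm (E t - E (t + j)) \<le> real j * q" for j
  proof (induction j)
    case (Suc j)
    have "norm (E t - E (t + Suc j)) \<le> norm (E t - E (t + j)) + norm (E (t + j) - E (Suc (t + j)))"
      using norm_triangle_ineq[of "E t - E (t + j)" "E (t + j) - E (Suc (t + j))"] by simp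
    also have "\<dots> \<le> real j * q + q"
      using Suc E[of j] by (simp add: norm_minus_commute)
    finally show ?case by (simp add: algebra_simps)
  qed simp
  have s: "norm (s j) \<le> 2 * (\<rho> ^ j * S)" for j
  proof -
    have "norm (s j) \<le> norm (u (t + Suc j)) + norm (u (t + j))"
      by (simp add: s_def norm_triangle_ineq4)
    also have "\<dots> \<le> \<rho> ^ Suc j * S + \<rho> ^ j * S" by (intro add_mono u)
    also have "\<rho> ^ Suc j * S \<le> \<rho> ^ j * S"
      using \<rho> S0 by (intro mult_right_mono power_decreasing) auto
    finally show ?thesis by linarith
  qed
  \<comment> \<open>The Dennis-More bound for the increment at time \<open>t + j\<close> concerns
    \<open>E (t + j)\<close>; freezing the matrix at \<open>E t\<close> costs a drift of at most
    \<open>j\<close> times \<open>q\<close>.\<close>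
  have Es: "norm (E t *v s j) \<le> 2 * S * q * (real (Suc j) * \<rho> ^ j)" for j
  proof -
    have "E t *v s j = (E t - E (t + j)) *v s j + E (t + j) *v s j"
      by (simp add: matrix_vector_mult_diff_rdistrib)
    then have "norm (E t *v s j) \<le> norm ((E t - E (t + j)) *v s j) + norm (E (t + j) *v s j)"
      by (metis norm_triangle_ineq)
    also have "\<dots> \<le> real j * q * norm (s j) + q * norm (s j)"
    proof (rule add_mono)
      show "norm ((E t - E (t + j)) *v s j) \<le> real j * q * norm (s j)"
        by (intro order_trans[OF norm_mult_vec_le] mult_right_mono Ej norm_ge_zero)
      show "norm (E (t + j) *v s j) \<le> q * norm (s j)" using q[of j] by (simp add: s_def)
    qed
    also have "\<dots> = q * real (Suc j) * norm (s j)" by (simp add: algebra_simps)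
    also have "\<dots> \<le> q * real (Suc j) * (2 * (\<rho> ^ j * S))"
      using q0 by (intro mult_left_mono s) auto
    finally show ?thesis by (simp only: mult_ac)
  qed
  \<comment> \<open>Telescoping stopped after \<open>J\<close> increments. The remainder vanishes as
    \<open>J\<close> grows with \<open>t\<close> fixed, so \<open>norm (E t)\<close> leaves no trace
    in the final bound.\<close>
  have partial: "norm (E t *v u t) \<le> norm (E t) * (\<rho> ^ J * S) + q * (2 * S / (1 - \<rho>)\<^sup>2)" for J
  proof -
    have "(\<Sum>j<J. s j) = u (t + J) - u t"
      unfolding s_def using sum_lessThan_telescope[of "\<lambda>j. u (t + j)" J] by simp
    then have "u t = u (t + J) - (\<Sum>j<J. s j)" by simp
    then have "E t *v u t = E t *v u (t + J) - (\<Sum>j<J. E t *v s j)"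
      by (metis matrix_vector_mult_diff_distrib linear_sum[OF matrix_vector_mul_linear])
    then have "norm (E t *v u t) \<le> norm (E t *v u (t + J)) + norm (\<Sum>j<J. E t *v s j)"
      by (simp only: norm_triangle_ineq4)
    also have "norm (\<Sum>j<J. E t *v s j) \<le> (\<Sum>j<J. norm (E t *v s j))"
      by (rule norm_sum)
    also have "norm (E t *v u (t + J)) \<le> norm (E t) * (\<rho> ^ J * S)"
      by (intro order_trans[OF norm_mult_vec_le] mult_left_mono u) simp
    also have "(\<Sum>j<J. norm (E t *v s j)) \<le> (\<Sum>j<J. 2 * S * q * (real (Suc j) * \<rho> ^ j))"
      by (intro sum_mono Es)
    also have "\<dots> = 2 * S * q * (\<Sum>j<J. real (Suc j) * \<rho> ^ j)"
      by (simp only: sum_distrib_left)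
    also have "\<dots> \<le> 2 * S * q * (1 / (1 - \<rho>)\<^sup>2)"
      using S0 q0 \<rho> by (intro mult_left_mono sum_Suc_mult_power_le) auto
    finally show ?thesis by (simp add: mult_ac)
  qed
  have "(\<lambda>J. norm (E t) * (\<rho> ^ J * S) + q * (2 * S / (1 - \<rho>)\<^sup>2)) \<longlonglongrightarrow> norm (E t) * (0 * S) + q * (2 * S / (1 - \<rho>)\<^sup>2)"
    using \<rho> by (intro tendsto_intros LIMSEQ_power_zero) simp
  then show ?thesis
    using partial by (intro LIMSEQ_le_const[of _ "q * (2 * S / (1 - \<rho>)\<^sup>2)"]) (auto intro: exI[of _ 0])
qed

section \<open>Gradients and Hessians\<close>

text \<open>Justifies the definite description in \<open>gradient\<close>: the adjoint of the
  derivative, applied to 1, represents it, and derivatives are unique.\<close>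

lemma GDERIV_gradient:
  fixes f :: "real^'p \<Rightarrow> real"
  assumes "f differentiable (at x)"
  shows "GDERIV f x :> gradient f x"
proof -
  obtain f' where f': "(f has_derivative f') (at x)"
    using assms by (auto simp: differentiable_def)
  have "f' h = h \<bullet> adjoint f' 1" for h
    using adjoint_works[OF has_derivative_linear[OF f'], of h 1] by simp
  then have "f' = (\<lambda>h. h \<bullet> adjoint f' 1)" by blast
  then have D: "GDERIV f x :> adjoint f' 1"
    using f' unfolding gderiv_def by metis
  moreover have "D' = adjoint f' 1" if "GDERIV f x :> D'" for D'
  proof -
    have "(\<lambda>h. h \<bullet> D') = (\<lambda>h. h \<bullet> adjoint f' 1)"
      using that D has_derivative_unique unfolding gderiv_def by blast
    then show ?thesis by (metis vector_eq_ldot)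
  qed
  ultimately show ?thesis
    unfolding gradient_def by (rule theI)
qed

lemma has_derivative_gradient:
  assumes "twice_differentiable f"
  shows "(gradient f has_derivative (\<lambda>h. hessian f x *v h)) (at x)"
  using assms jacobian_works[of "gradient f" "at x"] by (simp add: twice_differentiable_def hessian_def)

text \<open>Mean value inequality on the ball of radius \<sigma> around \<open>w\<close>, which
  contains the segment from \<open>v\<close> to \<open>u\<close> by convexity. The base point is
  free: the minimizer gives the secant error against a fixed Hessian, and \<open>w = v\<close> gives
  the usual quadratic remainder.\<close>

lemma gradient_linearization:
  fixes f :: "real^'p \<Rightarrow> real"
  assumes f: "twice_differentiable f"
    and lip: "\<And>u v. induced_norm (hessian f u - hessian f v) \<le> M * norm (u - v)" and M: "0 \<le> M"
    and uv: "norm (u - w) \<le> \<sigma>" "norm (v - w) \<le> \<sigma>"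
  shows "norm (gradient f u - gradient f v - hessian f w *v (u - v)) \<le> M * \<sigma> * norm (u - v)"
proof -
  have "norm (gradient f u - gradient f v - hessian f w *v (u - v)) \<le> norm (u - v) * (M * \<sigma>)"
  proof (rule differentiable_bound_linearization[where S = "cball w \<sigma>" and f' = "\<lambda>x h. hessian f x *v h"])
    show "v + t *\<^sub>R (u - v) \<in> cball w \<sigma>" if "t \<in> {0..1}" for t
    proof -
      have "(1 - t) *\<^sub>R v + t *\<^sub>R u \<in> cball w \<sigma>"
        using that uv by (intro convexD[OF convex_cball]) (auto simp: dist_norm norm_minus_commute)
      then show ?thesis by (simp add: algebra_simps)
    qed
    show "(gradient f has_derivative (\<lambda>h. hessian f x *v h)) (at x within cball w \<sigma>)" for x
      using has_derivative_gradient[OF f] has_derivative_at_withinI by blast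
    show "onorm ((*v) (hessian f x) - (*v) (hessian f w)) \<le> M * \<sigma>" if "x \<in> cball w \<sigma>" for x
    proof -
      have "(*v) (hessian f x) - (*v) (hessian f w) = (*v) (hessian f x - hessian f w)"
        by (simp add: fun_eq_iff matrix_vector_mult_diff_rdistrib)
      then have "onorm ((*v) (hessian f x) - (*v) (hessian f w)) \<le> M * norm (x - w)"
        using lip[of x w] by (simp add: induced_norm_def)
      also have "\<dots> \<le> M * \<sigma>"
        using that M by (intro mult_left_mono) (auto simp: dist_norm norm_minus_commute)
      finally show ?thesis .
    qed
    show "w \<in> cball w \<sigma>"
      using order_trans[OF norm_ge_zero uv(1)] by simp
  qed
  then show ?thesis by (simp add: mult_ac)
qed

text \<open>Both \<open>h \<bullet> H k\<close> and \<open>k \<bullet> H h\<close> approximate the second difference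
  \<open>f (x + h + k) - f (x + h) - f (x + k) + f x\<close> up to a cubic error.\<close>

lemma symmetric_hessian:
  fixes f :: "real^'p \<Rightarrow> real"
  assumes f: "twice_differentiable f"
    and lip: "\<And>u v. induced_norm (hessian f u - hessian f v) \<le> M * norm (u - v)" and M: "0 \<le> M"
  shows "transpose (hessian f x) = hessian f x"
proof (rule symmetric_matrixI)
  fix h k :: "real^'p"
  let ?H = "hessian f x"
  have second_difference:
    "\<bar>f (x + h + k) - f (x + h) - f (x + k) + f x - h \<bullet> (?H *v k)\<bar> \<le> M * (norm h + norm k) * norm k * norm h"
    for h k :: "real^'p"
  proof -
    \<comment> \<open>The deviation of the second difference from h . H k is the increment of
      \<open>g\<close> in direction \<open>h\<close>. The gradient of \<open>g\<close> is a
      linearization remainder in direction \<open>k\<close>, hence small.\<close>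
    define g where "g u = f (u + k) - f u - u \<bullet> (?H *v k)" for u
    have g': "(g has_derivative (\<lambda>v. v \<bullet> (gradient f (u + k) - gradient f u - ?H *v k))) (at u within S)" for u S
    proof -
      have D: "(f has_derivative (\<lambda>v. v \<bullet> gradient f u)) (at u)" for u
        using f GDERIV_gradient by (auto simp: twice_differentiable_def gderiv_def)
      have "((\<lambda>u. f (u + k)) has_derivative (\<lambda>v. v \<bullet> gradient f (u + k))) (at u within S)"
        by (rule has_derivative_compose[of "\<lambda>u. u + k" "\<lambda>v. v" u S f, OF _ D])
           (auto intro!: derivative_eq_intros)
      then show ?thesis
        unfolding g_def inner_diff_right
        by (intro has_derivative_diff has_derivative_at_withinI[OF D] bounded_linear_imp_has_derivative
            bounded_linear_inner_left)
    qed
    have "norm (g (x + h) - g x) \<le> (M * (norm h + norm k) * norm k) * norm ((x + h) - x)"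
    proof (rule differentiable_bound[OF convex_cball[of x "norm h"] g'])
      fix u assume u: "u \<in> cball x (norm h)"
      have "norm (gradient f (u + k) - gradient f u - ?H *v ((u + k) - u))
          \<le> M * (norm h + norm k) * norm ((u + k) - u)"
      proof (rule gradient_linearization[OF f lip M])
        have "norm (u - x) \<le> norm h"
          using u by (simp add: dist_norm norm_minus_commute)
        moreover have "norm (u + k - x) \<le> norm (u - x) + norm k"
          by (metis add_diff_eq diff_add_eq norm_triangle_ineq)
        ultimately show "norm (u + k - x) \<le> norm h + norm k" "norm (u - x) \<le> norm h + norm k"
          by (simp_all add: add_increasing2)
      qed
      then have *: "norm (gradient f (u + k) - gradient f u - ?H *v k) \<le> M * (norm h + norm k) * norm k"
        by simp
      show "onorm (\<lambda>v. v \<bullet> (gradient f (u + k) - gradient f u - ?H *v k)) \<le> M * (norm h + norm k) * norm k"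
      proof (rule onorm_le)
        fix v :: "real^'p"
        have "norm (v \<bullet> (gradient f (u + k) - gradient f u - ?H *v k))
            \<le> norm v * norm (gradient f (u + k) - gradient f u - ?H *v k)"
          by (simp add: Cauchy_Schwarz_ineq2)
        also have "\<dots> \<le> norm v * (M * (norm h + norm k) * norm k)"
          by (rule mult_left_mono[OF *]) simp
        finally show "norm (v \<bullet> (gradient f (u + k) - gradient f u - ?H *v k)) \<le> M * (norm h + norm k) * norm k * norm v"
          by (simp add: mult_ac)
      qed
    qed (auto simp: dist_norm)
    moreover have "g (x + h) - g x = f (x + h + k) - f (x + h) - f (x + k) + f x - h \<bullet> (?H *v k)"
      by (simp add: g_def inner_add_left)
    ultimately show ?thesis by simp
  qed
  \<comment> \<open>Scaling \<open>h\<close> and \<open>k\<close> by \<open>t\<close> multiplies the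
    asymmetry by t^2 but the error by t^3, so letting \<open>t\<close> tend to 0 removes the
    error.\<close>
  define c where "c = 2 * (M * (norm h + norm k) * norm k * norm h)"
  have bound: "\<bar>h \<bullet> (?H *v k) - k \<bullet> (?H *v h)\<bar> \<le> c * t" if t: "0 < t" for t
  proof -
    have swap: "x + t *\<^sub>R k + t *\<^sub>R h = x + t *\<^sub>R h + t *\<^sub>R k"
      by (simp add: add_ac)
    have "\<bar>(t *\<^sub>R h) \<bullet> (?H *v (t *\<^sub>R k)) - (t *\<^sub>R k) \<bullet> (?H *v (t *\<^sub>R h))\<bar>
        \<le> M * (norm (t *\<^sub>R h) + norm (t *\<^sub>R k)) * norm (t *\<^sub>R k) * norm (t *\<^sub>R h)
          + M * (norm (t *\<^sub>R k) + norm (t *\<^sub>R h)) * norm (t *\<^sub>R h) * norm (t *\<^sub>R k)"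
      using second_difference[of "t *\<^sub>R h" "t *\<^sub>R k"] second_difference[of "t *\<^sub>R k" "t *\<^sub>R h"]
      unfolding swap by linarith
    also have "\<dots> = (t * t) * (c * t)"
      using t by (simp add: c_def algebra_simps)
    also have "\<bar>(t *\<^sub>R h) \<bullet> (?H *v (t *\<^sub>R k)) - (t *\<^sub>R k) \<bullet> (?H *v (t *\<^sub>R h))\<bar>
        = (t * t) * \<bar>h \<bullet> (?H *v k) - k \<bullet> (?H *v h)\<bar>"
      by (simp add: matrix_vector_mult_scaleR mult.assoc[symmetric] right_diff_distrib[symmetric] abs_mult)
    finally show ?thesis using t by (simp add: mult_le_cancel_left)
  qed
  have "\<bar>h \<bullet> (?H *v k) - k \<bullet> (?H *v h)\<bar> \<le> 0"
  proof (rule tendsto_lowerbound)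
    show "((\<lambda>t. c * t) \<longlongrightarrow> 0) (at_right 0)"
      by (rule tendsto_eq_intros refl | simp)+
    show "eventually (\<lambda>t. \<bar>h \<bullet> (?H *v k) - k \<bullet> (?H *v h)\<bar> \<le> c * t) (at_right 0)"
      using bound by (auto intro: eventually_at_rightI[of 0 1])
  qed simp
  then show "h \<bullet> (?H *v k) = k \<bullet> (?H *v h)" by simp
qed

text \<open>Strong monotonicity between x + t v and x, divided by t^2, gives the claim up to a
  linearization remainder of order \<open>t\<close>.\<close>

lemma hessian_coercive:
  fixes f :: "real^'p \<Rightarrow> real"
  assumes f: "twice_differentiable f"
    and lip: "\<And>u v. induced_norm (hessian f u - hessian f v) \<le> M * norm (u - v)" and M: "0 \<le> M"
    and mono: "\<And>u v. \<mu> * (norm (u - v))\<^sup>2 \<le> (gradient f u - gradient f v) \<bullet> (u - v)"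
  shows "\<mu> * (norm v)\<^sup>2 \<le> v \<bullet> (hessian f x *v v)"
proof (rule tendsto_lowerbound)
  show "((\<lambda>t. v \<bullet> (hessian f x *v v) + M * t * norm v * norm v * norm v) \<longlongrightarrow> v \<bullet> (hessian f x *v v)) (at_right 0)"
    by (rule tendsto_eq_intros refl | simp)+
  have "\<mu> * (norm v)\<^sup>2 \<le> v \<bullet> (hessian f x *v v) + M * t * norm v * norm v * norm v" if t: "0 < t" for t
  proof -
    let ?R = "gradient f (x + t *\<^sub>R v) - gradient f x - hessian f x *v (t *\<^sub>R v)"
    have R: "norm ?R \<le> M * (t * norm v) * (t * norm v)"
      using gradient_linearization[OF f lip M, of "x + t *\<^sub>R v" x "t * norm v" x] t by simp
    have "\<mu> * (t * t) * (norm v)\<^sup>2 \<le> (gradient f (x + t *\<^sub>R v) - gradient f x) \<bullet> (t *\<^sub>R v)"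
      using mono[of "x + t *\<^sub>R v" x] by (simp add: power_mult_distrib power2_eq_square[of t] mult_ac)
    also have "\<dots> = t * t * (v \<bullet> (hessian f x *v v)) + ?R \<bullet> (t *\<^sub>R v)"
      by (simp add: matrix_vector_mult_scaleR inner_diff_left inner_commute algebra_simps)
    also have "?R \<bullet> (t *\<^sub>R v) \<le> norm ?R * norm (t *\<^sub>R v)"
      by (rule norm_cauchy_schwarz)
    also have "\<dots> \<le> M * (t * norm v) * (t * norm v) * (t * norm v)"
      using R t by (simp add: mult_right_mono)
    finally have "(t * t) * (\<mu> * (norm v)\<^sup>2) \<le> (t * t) * (v \<bullet> (hessian f x *v v) + M * t * norm v * norm v * norm v)"
      by (simp add: algebra_simps)
    then show ?thesis using t by (simp add: mult_le_cancel_left)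
  qed
  then show "eventually (\<lambda>t. \<mu> * (norm v)\<^sup>2 \<le> v \<bullet> (hessian f x *v v) + M * t * norm v * norm v * norm v) (at_right 0)"
    by (auto intro: eventually_at_rightI[of 0 1])
qed simp

lemma sum_gradient_zero_at_minimizer:
  fixes f :: "nat \<Rightarrow> real^'p \<Rightarrow> real"
  assumes diff: "\<And>i. i \<in> I \<Longrightarrow> f i differentiable (at xs)" and c: "c \<noteq> 0"
    and min: "\<And>y. c * (\<Sum>i\<in>I. f i xs) \<le> c * (\<Sum>i\<in>I. f i y)"
  shows "(\<Sum>i\<in>I. gradient (f i) xs) = 0"
proof -
  have "((\<lambda>y. c * (\<Sum>i\<in>I. f i y)) has_derivative (\<lambda>h. c * (\<Sum>i\<in>I. h \<bullet> gradient (f i) xs))) (at xs)"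
    using GDERIV_gradient[OF diff]
    by (intro has_derivative_mult_right has_derivative_sum) (auto simp: gderiv_def)
  then have "(\<lambda>h. c * (\<Sum>i\<in>I. h \<bullet> gradient (f i) xs)) = (\<lambda>h. 0)"
    by (rule differential_zero_maxmin[OF UNIV_I open_UNIV]) (use min in auto)
  then have "h \<bullet> (\<Sum>i\<in>I. gradient (f i) xs) = 0" for h
    using c by (auto simp: fun_eq_iff inner_sum_right)
  then show ?thesis by (metis inner_eq_zero_iff)
qed

section \<open>Superlinear convergence of IQN\<close>

lemma iqn_runD:
  assumes "iqn_run n f x z B" and "i \<in> {1..n}"
  shows "z 0 i = x 0" "sym_pos_def (B 0 i)"
    and "z (Suc t) i = (if i = iqn_index n t then x (Suc t) else z t i)"
    and "B (Suc t) i = (if i = iqn_index n t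
           then bfgs_update (B t i) (z (Suc t) i - z t i)
                  (gradient (f i) (z (Suc t) i) - gradient (f i) (z t i))
           else B t i)"
    and "i = iqn_index n t \<Longrightarrow> z (Suc t) i - z t i \<noteq> 0"
  using assms unfolding iqn_run_def by blast+

lemma iqn_index_range: "1 \<le> n \<Longrightarrow> iqn_index n t \<in> {1..n}"
  by (simp add: iqn_index_def Suc_leI)

text \<open>Index \<open>i\<close> is first refreshed in the step that produces \<open>x i\<close>,
  and then every \<open>n\<close> steps. Hence \<open>z t i\<close> is \<open>x 0\<close> for t < i,
  and afterwards the iterate of index t - ((t - i) mod n).\<close>

lemma iqn_run_delay:
  assumes run: "iqn_run n f x z B" and i: "i \<in> {1..n}"
  shows "\<exists>\<tau>\<le>t. z t i = x \<tau> \<and> t \<le> \<tau> + n"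
proof (cases "t < i")
  case True
  then have "z t i = x 0"
  proof (induction t)
    case (Suc t)
    then have "iqn_index n t \<noteq> i" using i by (simp add: iqn_index_def)
    then show ?case using Suc iqn_runD(3)[OF run i] by auto
  qed (rule iqn_runD(1)[OF run i])
  then show ?thesis using True i by auto
next
  case False
  define k where "k = (t - i) div n"
  define j where "j = (t - i) mod n"
  have j: "j < n" using i by (simp add: j_def)
  have t: "t = n * k + i + j"
    using False mult_div_mod_eq[of n "t - i"] by (simp add: k_def j_def)
  from j have "z (n * k + i + j) i = x (n * k + i)"
  proof (induction j)
    case 0
    obtain i' where i': "i = Suc i'" using i by (cases i) auto
    have "iqn_index n (n * k + i') = i" using i by (simp add: iqn_index_def i')
    then show ?case using iqn_runD(3)[OF run i, of "n * k + i'"] by (simp add: i')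
  next
    case (Suc j)
    have "iqn_index n (n * k + i + j) \<noteq> i"
    proof (cases "i + j < n")
      case False
      then have "(i + j) mod n = i + j - n"
        using i Suc.prems by (simp add: le_mod_geq)
      then show ?thesis using False Suc.prems by (simp add: iqn_index_def add.assoc)
    qed (simp add: iqn_index_def add.assoc)
    then show ?case using Suc iqn_runD(3)[OF run i, of "n * k + i + j"] by auto
  qed
  then show ?thesis using j unfolding t by (intro exI[of _ "n * k + i"]) auto
qed

text \<open>The exponent is the ceiling of t / n. As r < 1, the staircase rate lies below the
  geometric sequence of ratio r^(1/n), with equality at t = 0.\<close>

lemma power_int_ceiling_bound:
  fixes r :: real
  assumes r: "0 < r" "r < 1" and n: "1 \<le> n"
  shows "r powi (\<lfloor>(real t - 1) / real n\<rfloor> + 1) \<le> (r powr (1 / real n)) ^ t"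
proof -
  define k where "k = \<lfloor>(real t - 1) / real n\<rfloor> + 1"
  have "real t / real n \<le> real_of_int k"
  proof -
    have "\<lfloor>(real t - 1) / real n\<rfloor> = (int t - 1) div int n"
      using floor_divide_of_int_eq[of "int t - 1" "int n", where 'a = real] by simp
    moreover have "(int t - 1) mod int n < int n" using n by simp
    then have "int t - 1 < int n * ((int t - 1) div int n) + int n"
      using mult_div_mod_eq[of "int n" "int t - 1"] by linarith
    ultimately have "int t \<le> int n * k" by (simp add: k_def distrib_left)
    then have "real t \<le> real n * real_of_int k"
      by (metis of_int_le_iff of_int_mult of_int_of_nat_eq)
    then show ?thesis using n by (simp add: divide_le_eq mult.commute)
  qed
  then have "r powr real_of_int k \<le> r powr (real t / real n)"
    using r by (simp add: powr_mono')
  also have "\<dots> = (r powr (1 / real n)) ^ t"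
    using r by (simp add: powr_realpow[symmetric] powr_powr)
  finally show ?thesis
    using r powr_real_of_int'[of r k] unfolding k_def[symmetric] by simp
qed

theorem theorem4p7:
  fixes f :: "nat \<Rightarrow> real^'p \<Rightarrow> real"
    and n :: nat
    and xs :: "real^'p"
    and \<mu> L Lt r \<epsilon> \<delta> :: real
    and x :: "nat \<Rightarrow> real^'p"
    and z :: "nat \<Rightarrow> nat \<Rightarrow> real^'p"
    and B :: "nat \<Rightarrow> nat \<Rightarrow> real^'p^'p"
  assumes "1 \<le> n"
    and "\<And>i. i \<in> {1..n} \<Longrightarrow> twice_differentiable (f i)"
    and "unique_minimizer (\<lambda>y. (1 / real n) * (\<Sum>i\<in>{1..n}. f i y)) xs"
    and "0 < \<mu>" and "\<mu> \<le> L"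
    and "\<And>i u v. i \<in> {1..n} \<Longrightarrow>
           \<mu> * (norm (u - v))\<^sup>2 \<le> (gradient (f i) u - gradient (f i) v) \<bullet> (u - v) \<and>
           (gradient (f i) u - gradient (f i) v) \<bullet> (u - v) \<le> L * (norm (u - v))\<^sup>2"
    and "0 < Lt"
    and "\<And>i u v. i \<in> {1..n} \<Longrightarrow>
           induced_norm (hessian (f i) u - hessian (f i) v) \<le> Lt * norm (u - v)"
    and "0 < r" and "r < 1"
    and "admissible_pair n f xs r \<epsilon> \<delta>"
    and "iqn_run n f x z B"
    and "iqn_init_close n f xs \<epsilon> \<delta> (x 0) (B 0)"
    and "\<And>t. max (norm (z (Suc t) (iqn_index n t) - xs)) (norm (z t (iqn_index n t) - xs))
              < \<mu> / (3 * Lt)"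
  shows "(\<exists>\<phi>. strict_mono \<phi> \<and> superlinear_to_zero (\<lambda>k. norm (x (\<phi> k) - xs))) \<and>
         (\<exists>\<zeta>. (\<forall>t. norm (x t - xs) \<le> \<zeta> t) \<and> superlinear_to_zero \<zeta>)"
proof -
  note n = assms(1) and diff = assms(2) and \<mu> = assms(4) and Lt = assms(7) and lip = assms(8)
    and r = assms(9,10) and run = assms(12)
  have mono: "\<mu> * (norm (u - v))\<^sup>2 \<le> (gradient (f i) u - gradient (f i) v) \<bullet> (u - v)" if "i \<in> {1..n}" for i u v
    using assms(6)[OF that] by blast
  define a where "a t = norm (x t - xs)" for t
  define \<rho> where "\<rho> = r powr (1 / real n)"
  have \<rho>: "0 < \<rho>" "\<rho> < 1"
    using r n by (simp_all add: \<rho>_def powr01_less_one)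
  obtain C0 where lin: "\<And>t. norm (x t - xs) \<le> r powi (\<lfloor>(real t - 1) / real n\<rfloor> + 1) * norm (x 0 - xs)"
    and C0: "\<And>i t. i \<in> {1..n} \<Longrightarrow> induced_norm (B t i) \<le> C0"
      "\<And>i t. i \<in> {1..n} \<Longrightarrow> induced_norm (matrix_inv (B t i)) \<le> C0"
    using assms(11) run assms(13) unfolding admissible_pair_def by blast
  define C where "C = max C0 1"
  have C: "0 < C" "C0 \<le> C" by (simp_all add: C_def)
  have a_bound: "a t \<le> a 0 * \<rho> ^ t" for t
  proof -
    have "a t \<le> r powi (\<lfloor>(real t - 1) / real n\<rfloor> + 1) * a 0" unfolding a_def by (rule lin)
    also have "\<dots> \<le> \<rho> ^ t * a 0"
      unfolding \<rho>_def by (intro mult_right_mono power_int_ceiling_bound r n) (simp add: a_def)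
    finally show ?thesis by (simp add: mult.commute)
  qed
  \<comment> \<open>Division by \<open>\<rho> ^ n\<close> pays for the age, at most
    \<open>n\<close>, of the stored points.\<close>
  define D where "D = a 0 / \<rho> ^ n"
  have D: "0 \<le> D" using \<rho> by (simp add: D_def a_def)
  have z_bound: "norm (z t i - xs) \<le> D * \<rho> ^ t" if i: "i \<in> {1..n}" for t i
  proof -
    obtain \<tau> where \<tau>: "z t i = x \<tau>" "t \<le> \<tau> + n" using iqn_run_delay[OF run i] by blast
    have "norm (z t i - xs) \<le> a 0 * \<rho> ^ \<tau>" using a_bound[of \<tau>] by (simp add: a_def \<tau>)
    also have "\<dots> = D * \<rho> ^ (\<tau> + n)" using \<rho> by (simp add: D_def power_add)
    also have "\<dots> \<le> D * \<rho> ^ t" using D \<rho> \<tau>(2) by (intro mult_left_mono power_decreasing) auto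
    finally show ?thesis .
  qed
  define s where "s i t = z (Suc t) i - z t i" for i t
  define y where "y i t = gradient (f i) (z (Suc t) i) - gradient (f i) (z t i)" for i t
  define H where "H i = hessian (f i) xs" for i
  \<comment> \<open>Between its visits, \<open>z\<close> at index \<open>i\<close> rests and
    \<open>s i t\<close> is 0; at a visit it is nonzero by the definition of a run. So every index
    can be followed on the common clock \<open>t\<close>.\<close>
  have step: "B (Suc t) i = (if s i t = 0 then B t i else bfgs_update (B t i) (s i t) (y i t))"
    if i: "i \<in> {1..n}" for i t
  proof (cases "i = iqn_index n t")
    case True
    then show ?thesis using iqn_runD(4)[OF run i, of t] iqn_runD(5)[OF run i True]
      by (simp only: s_def y_def if_True if_False simp_thms)
  next
    case False
    then show ?thesis using iqn_runD(3,4)[OF run i, of t] by (simp add: s_def)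
  qed
  have ys: "\<mu> * (norm (s i t))\<^sup>2 \<le> y i t \<bullet> s i t" if "i \<in> {1..n}" for i t
    using mono[OF that] by (simp add: s_def y_def)
  have spd: "sym_pos_def (B t i)" if i: "i \<in> {1..n}" for t i
  proof (induction t)
    case (Suc t)
    have "0 < y i t \<bullet> s i t" if "s i t \<noteq> 0"
      by (rule less_le_trans[OF _ ys[OF i]]) (use that \<mu> in simp)
    then show ?case using Suc sym_pos_def_bfgs_update by (auto simp: step[OF i])
  qed (rule iqn_runD(2)[OF run i])
  have coercive: "(norm v)\<^sup>2 / C \<le> v \<bullet> (B t i *v v)" if i: "i \<in> {1..n}" for t i v
    using sym_pos_def_coercive[OF spd[OF i] order_trans[OF C0(2)[OF i] C(2)]] C(1)
    by (simp add: divide_le_eq mult.commute)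
  have "\<exists>q. q \<longlonglongrightarrow> 0 \<and> (\<forall>t. norm ((B t i - H i) *v s i t) \<le> q t * norm (s i t)) \<and>
      (\<forall>t. norm (B (Suc t) i - B t i) \<le> q t)" if i: "i \<in> {1..n}" for i
  proof -
    define m where "m = min \<mu> (1 / C)"
    have m: "0 < m" "m \<le> \<mu>" "m \<le> 1 / C" using \<mu> C by (simp_all add: m_def)
    have le: "m * (norm v)\<^sup>2 \<le> \<mu> * (norm v)\<^sup>2" "m * (norm v)\<^sup>2 \<le> (norm v)\<^sup>2 / C" for v :: "real^'p"
      using mult_right_mono[OF m(2), of "(norm v)\<^sup>2"] mult_right_mono[OF m(3), of "(norm v)\<^sup>2"] by simp_all
    obtain q where "q \<longlonglongrightarrow> 0" "\<And>t. 0 \<le> q t"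
      "\<And>t. norm ((B t i - H i) *v s i t) \<le> q t * norm (s i t)"
      "\<And>t. norm (B (Suc t) i - B t i) \<le> q t"
    proof (rule bfgs_Dennis_More[of m "H i" "\<lambda>t. B t i" _ "s i" "y i" "\<lambda>t. Lt * (D * \<rho> ^ t)"])
      show "0 < m" by (rule m)
      show "transpose (H i) = H i"
        unfolding H_def using symmetric_hessian[OF diff[OF i] lip[OF i]] Lt by simp
      show "m * (norm v)\<^sup>2 \<le> v \<bullet> (H i *v v)" for v
        unfolding H_def
        by (rule order_trans[OF le(1) hessian_coercive[OF diff[OF i] lip[OF i] _ mono[OF i]]])
           (use Lt in simp)
      show "transpose (B t i) = B t i" for t using spd[OF i] by (simp add: sym_pos_def_def)
      show "m * (norm v)\<^sup>2 \<le> v \<bullet> (B t i *v v)" for t v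
        by (rule order_trans[OF le(2) coercive[OF i]])
      show "norm (B t i) \<le> real CARD('p) * real CARD('p) * C" for t
        by (rule order_trans[OF norm_matrix_le_onorm])
           (use C0(1)[OF i, of t] C in \<open>auto simp: induced_norm_def intro!: mult_left_mono\<close>)
      show "B (Suc t) i = (if s i t = 0 then B t i else bfgs_update (B t i) (s i t) (y i t))" for t
        by (rule step[OF i])
      show "m * (norm (s i t))\<^sup>2 \<le> y i t \<bullet> s i t" for t
        by (rule order_trans[OF le(1) ys[OF i]])
      \<comment> \<open>Linearization at the minimizer: both endpoints of the step lie within
        \<open>D * \<rho> ^ t\<close> of it. The R-linear rate is thus what makes the secant errors
        summable.\<close>
      show "norm (y i t - H i *v s i t) \<le> Lt * (D * \<rho> ^ t) * norm (s i t)" for t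
        unfolding y_def s_def H_def
      proof (rule gradient_linearization[OF diff[OF i] lip[OF i]])
        have "D * \<rho> ^ Suc t \<le> D * \<rho> ^ t" using D \<rho> by (intro mult_left_mono power_decreasing) auto
        then show "norm (z (Suc t) i - xs) \<le> D * \<rho> ^ t" using z_bound[OF i, of "Suc t"] by simp
      qed (use Lt z_bound[OF i] in auto)
      show "0 \<le> Lt * (D * \<rho> ^ t)" for t using Lt D \<rho> by simp
      show "summable (\<lambda>t. Lt * (D * \<rho> ^ t))" using \<rho> by (intro summable_mult summable_geometric) simp
    qed (rule that)
    then show ?thesis by blast
  qed
  then obtain q where q: "\<And>i. i \<in> {1..n} \<Longrightarrow> q i \<longlonglongrightarrow> 0"
    "\<And>i t. i \<in> {1..n} \<Longrightarrow> norm ((B t i - H i) *v s i t) \<le> q i t * norm (s i t)"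
    "\<And>i t. i \<in> {1..n} \<Longrightarrow> norm (B (Suc t) i - B t i) \<le> q i t"
    by metis
  have stationary: "(\<Sum>i\<in>{1..n}. gradient (f i) xs) = 0"
  proof (rule sum_gradient_zero_at_minimizer[where c = "1 / real n"])
    show "f i differentiable (at xs)" if "i \<in> {1..n}" for i
      using diff[OF that] by (simp add: twice_differentiable_def)
  qed (use n assms(3) in \<open>auto simp: unique_minimizer_def\<close>)
  \<comment> \<open>Multiply the update by the sum \<open>A\<close> of the matrices and subtract
    \<open>A *v xs\<close>. As the gradients at \<open>xs\<close> sum to zero, A e is a sum of terms
    E u minus linearization remainders; coercivity of \<open>A\<close> with constant n / C does the
    rest.\<close>
  have error: "norm (x (Suc t) - xs) \<le> C / real n *
      (\<Sum>i\<in>{1..n}. norm ((B t i - H i) *v (z t i - xs)) + Lt * norm (z t i - xs) * norm (z t i - xs))" for t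
  proof -
    define A where "A = (\<Sum>i\<in>{1..n}. B t i)"
    define e where "e = x (Suc t) - xs"
    have A_coercive: "real n * ((norm v)\<^sup>2 / C) \<le> v \<bullet> (A *v v)" for v
    proof -
      have "v \<bullet> (A *v v) = (\<Sum>i\<in>{1..n}. v \<bullet> (B t i *v v))"
        unfolding A_def
        by (induction n) (simp_all add: matrix_vector_mult_add_rdistrib inner_add_right)
      moreover have "(\<Sum>i\<in>{1..n}. (norm v)\<^sup>2 / C) \<le> (\<Sum>i\<in>{1..n}. v \<bullet> (B t i *v v))"
        by (intro sum_mono coercive)
      ultimately show ?thesis by simp
    qed
    have "0 < v \<bullet> (((1 / real n) *\<^sub>R A) *v v)" if "v \<noteq> 0" for v
    proof -
      have "0 < real n * ((norm v)\<^sup>2 / C)" using n C that by simp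
      then show ?thesis
        using A_coercive[of v] n by (simp add: scaleR_matrix_vector_assoc[symmetric])
    qed
    then have inv: "invertible ((1 / real n) *\<^sub>R A)" by (rule positive_imp_invertible)
    have "x (Suc t) = matrix_inv ((1 / real n) *\<^sub>R A) *v
        ((1 / real n) *\<^sub>R (\<Sum>i\<in>{1..n}. B t i *v z t i) - (1 / real n) *\<^sub>R (\<Sum>i\<in>{1..n}. gradient (f i) (z t i)))"
      using run unfolding iqn_run_def A_def by blast
    then have "((1 / real n) *\<^sub>R A) *v x (Suc t)
        = (1 / real n) *\<^sub>R (\<Sum>i\<in>{1..n}. B t i *v z t i) - (1 / real n) *\<^sub>R (\<Sum>i\<in>{1..n}. gradient (f i) (z t i))"
      using matrix_inv_mult_vec(1)[OF inv] by simp
    then have "(1 / real n) *\<^sub>R (A *v x (Suc t))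
        = (1 / real n) *\<^sub>R ((\<Sum>i\<in>{1..n}. B t i *v z t i) - (\<Sum>i\<in>{1..n}. gradient (f i) (z t i)))"
      by (simp add: scaleR_matrix_vector_assoc scaleR_diff_right)
    then have "A *v x (Suc t) = (\<Sum>i\<in>{1..n}. B t i *v z t i) - (\<Sum>i\<in>{1..n}. gradient (f i) (z t i))"
      using n by simp
    moreover have "A *v xs = (\<Sum>i\<in>{1..n}. B t i *v xs)"
      unfolding A_def by (induction n) (simp_all add: matrix_vector_mult_add_rdistrib)
    ultimately have Ae: "A *v e = (\<Sum>i\<in>{1..n}. (B t i - H i) *v (z t i - xs)
        - (gradient (f i) (z t i) - gradient (f i) xs - H i *v (z t i - xs)))"
      using stationary
      by (simp add: e_def matrix_vector_mult_diff_distrib matrix_vector_mult_diff_rdistrib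
          sum_subtractf sum.distrib algebra_simps)
    have "norm (A *v e) \<le> (\<Sum>i\<in>{1..n}. norm ((B t i - H i) *v (z t i - xs)) + Lt * norm (z t i - xs) * norm (z t i - xs))"
      unfolding Ae
    proof (rule sum_norm_le)
      fix i assume i: "i \<in> {1..n}"
      have "norm (gradient (f i) (z t i) - gradient (f i) xs - H i *v (z t i - xs))
          \<le> Lt * norm (z t i - xs) * norm (z t i - xs)"
        unfolding H_def by (rule gradient_linearization[OF diff[OF i] lip[OF i]]) (use Lt in auto)
      then show "norm ((B t i - H i) *v (z t i - xs)
          - (gradient (f i) (z t i) - gradient (f i) xs - H i *v (z t i - xs)))
          \<le> norm ((B t i - H i) *v (z t i - xs)) + Lt * norm (z t i - xs) * norm (z t i - xs)"
        by (rule order_trans[OF norm_triangle_ineq4 add_left_mono])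
    qed
    moreover have "norm e \<le> C / real n * norm (A *v e)"
    proof (cases "e = 0")
      case False
      have "real n * ((norm e)\<^sup>2 / C) \<le> norm e * norm (A *v e)"
        by (rule order_trans[OF A_coercive norm_cauchy_schwarz])
      then have "norm e * norm e \<le> norm e * (C / real n * norm (A *v e))"
        using n C by (simp add: field_simps power2_eq_square)
      then show ?thesis by (rule mult_left_le_imp_le) (use False in simp)
    qed simp
    ultimately show ?thesis
      unfolding e_def using n C by (meson divide_nonneg_nonneg less_imp_le mult_left_mono of_nat_0_le_iff order_trans)
  qed
  \<comment> \<open>If the iterates were \<open>xs\<close> from time \<open>N\<close> on, every
    stored point would be \<open>xs\<close> by time \<open>N + n\<close>, and the next step would
    vanish, contrary to the definition of a run.\<close>
  have pos: "\<exists>t\<ge>N. 0 < a t" for N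
  proof (rule ccontr)
    assume "\<not> ?thesis"
    then have eq: "x t = xs" if "N \<le> t" for t using that by (auto simp: a_def)
    define i where "i = iqn_index n (N + n)"
    have i: "i \<in> {1..n}" unfolding i_def by (rule iqn_index_range[OF n])
    obtain \<tau> where "z (N + n) i = x \<tau>" "N + n \<le> \<tau> + n" using iqn_run_delay[OF run i] by blast
    then have "z (N + n) i = xs" using eq by simp
    moreover have "z (Suc (N + n)) i = xs"
      using iqn_runD(3)[OF run i, of "N + n"] eq by (simp add: i_def)
    ultimately show False using iqn_runD(5)[OF run i, of "N + n"] by (simp add: i_def)
  qed
  have a_lim: "a \<longlonglongrightarrow> 0"
  proof (rule tendsto_sandwich[OF _ _ tendsto_const])
    show "(\<lambda>t. a 0 * \<rho> ^ t) \<longlonglongrightarrow> 0"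
      using \<rho> by (intro tendsto_mult_right_zero LIMSEQ_power_zero) simp
  qed (simp_all add: a_bound, simp add: a_def)
  obtain \<zeta> where \<zeta>: "\<And>t. a t \<le> \<zeta> t" "superlinear_to_zero \<zeta>"
  proof (rule superlinear_majorant_forward_sup[OF \<rho> _ a_bound pos, of n])
    fix S :: "nat \<Rightarrow> real" and \<epsilon>' :: real
    assume aS: "\<And>t k. a (t + k) \<le> \<rho> ^ k * S t" and \<epsilon>': "0 < \<epsilon>'"
    \<comment> \<open>\<open>C\<close> bounds the inverse of the averaged matrix, 2 / (1 - \<rho>)^2
      comes from the residual bound for E u, and \<open>Lt\<close> from the linearization
      remainder.\<close>
    define K where "K = C * (2 / (1 - \<rho>)\<^sup>2 + Lt)"
    have K: "0 < K" unfolding K_def using C Lt \<rho> by (intro mult_pos_pos add_pos_pos divide_pos_pos) auto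
    define \<eta> where "\<eta> = \<epsilon>' / K"
    have \<eta>: "0 < \<eta>" using \<epsilon>' K by (simp add: \<eta>_def)
    have "(\<lambda>t. D * \<rho> ^ t) \<longlonglongrightarrow> 0"
      using \<rho> by (intro tendsto_mult_right_zero LIMSEQ_power_zero) simp
    then have "\<forall>\<^sub>F t in sequentially. D * \<rho> ^ t < \<eta>" by (rule order_tendstoD(2)[OF _ \<eta>])
    moreover have "\<forall>\<^sub>F t in sequentially. \<forall>i\<in>{1..n}. q i t < \<eta>"
      by (rule eventually_ball_finite) (use order_tendstoD(2)[OF q(1) \<eta>] in auto)
    ultimately have "\<forall>\<^sub>F t in sequentially. D * \<rho> ^ t < \<eta> \<and> (\<forall>i\<in>{1..n}. q i t < \<eta>)"
      by (rule eventually_conj)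
    then obtain T where T: "\<And>t. T \<le> t \<Longrightarrow> D * \<rho> ^ t < \<eta>"
      "\<And>t i. T \<le> t \<Longrightarrow> i \<in> {1..n} \<Longrightarrow> q i t < \<eta>"
      unfolding eventually_sequentially by blast
    have "a (Suc t + n) \<le> \<epsilon>' * S t" if t: "T \<le> t" for t
    proof -
      have S0: "0 \<le> S t" using order_trans[OF norm_ge_zero aS[of t 0, unfolded a_def]] by simp
      \<comment> \<open>After a delay of \<open>n\<close>, each stored point at time
        \<open>t + n + j\<close> is an iterate of index at least \<open>t + j\<close>, so the
        forward bound based at \<open>t\<close> applies to it.\<close>
      have u: "norm (z (t + n + j) i - xs) \<le> \<rho> ^ j * S t" if i: "i \<in> {1..n}" for i j
      proof -
        obtain \<tau> where \<tau>: "z (t + n + j) i = x \<tau>" "t + n + j \<le> \<tau> + n"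
          using iqn_run_delay[OF run i] by blast
        define k where "k = \<tau> - t"
        have k: "\<tau> = t + k" "j \<le> k" using \<tau>(2) by (simp_all add: k_def)
        have "norm (z (t + n + j) i - xs) \<le> \<rho> ^ k * S t" using aS[of t k] by (simp add: a_def \<tau> k)
        also have "\<dots> \<le> \<rho> ^ j * S t" using \<rho> k S0 by (intro mult_right_mono power_decreasing) auto
        finally show ?thesis .
      qed
      have "norm ((B (t + n) i - H i) *v (z (t + n) i - xs))
          + Lt * norm (z (t + n) i - xs) * norm (z (t + n) i - xs)
          \<le> \<eta> * (2 * S t / (1 - \<rho>)\<^sup>2) + Lt * \<eta> * S t" if i: "i \<in> {1..n}" for i
      proof (rule add_mono)
        have q': "q i (t + n + j) \<le> \<eta>" for j using T(2)[of "t + n + j" i] t i by simp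
        show "norm ((B (t + n) i - H i) *v (z (t + n) i - xs)) \<le> \<eta> * (2 * S t / (1 - \<rho>)\<^sup>2)"
        proof (rule slowly_varying_residual_bound[of "\<lambda>t. B t i - H i" "t + n" "\<lambda>t. z t i - xs" \<eta> \<rho> "S t"])
          show "norm ((B (t + n + j) i - H i) *v (z (Suc (t + n + j)) i - xs - (z (t + n + j) i - xs)))
              \<le> \<eta> * norm (z (Suc (t + n + j)) i - xs - (z (t + n + j) i - xs))" for j
            using order_trans[OF q(2)[OF i, of "t + n + j"] mult_right_mono[OF q'[of j] norm_ge_zero]]
            by (simp add: s_def)
          show "norm (B (Suc (t + n + j)) i - H i - (B (t + n + j) i - H i)) \<le> \<eta>" for j
            using order_trans[OF q(3)[OF i] q'] by simp
        qed (use u[OF i] \<rho> in auto)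
        have "norm (z (t + n) i - xs) \<le> \<eta>"
          using z_bound[OF i, of "t + n"] T(1)[of "t + n"] t by simp
        then show "Lt * norm (z (t + n) i - xs) * norm (z (t + n) i - xs) \<le> Lt * \<eta> * S t"
          using u[OF i, of 0] Lt \<eta> by (intro mult_mono) auto
      qed
      then have "(\<Sum>i\<in>{1..n}. norm ((B (t + n) i - H i) *v (z (t + n) i - xs))
          + Lt * norm (z (t + n) i - xs) * norm (z (t + n) i - xs))
          \<le> (\<Sum>i\<in>{1..n}. \<eta> * (2 * S t / (1 - \<rho>)\<^sup>2) + Lt * \<eta> * S t)"
        by (rule sum_mono)
      then have "C / real n * (\<Sum>i\<in>{1..n}. norm ((B (t + n) i - H i) *v (z (t + n) i - xs))
          + Lt * norm (z (t + n) i - xs) * norm (z (t + n) i - xs))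
          \<le> C / real n * (\<Sum>i\<in>{1..n}. \<eta> * (2 * S t / (1 - \<rho>)\<^sup>2) + Lt * \<eta> * S t)"
        using C by (intro mult_left_mono) auto
      also have "\<dots> = \<eta> * K * S t"
        using n by (simp add: K_def algebra_simps)
      also have "\<dots> = \<epsilon>' * S t" using K by (simp add: \<eta>_def)
      finally show ?thesis
        using error[of "t + n"] by (simp add: a_def)
    qed
    then show "\<exists>T. \<forall>t\<ge>T. a (Suc t + n) \<le> \<epsilon>' * S t" by blast
  next
    show "0 \<le> a t" for t by (simp add: a_def)
  qed (rule that)
  obtain \<phi> where "strict_mono \<phi>" "superlinear_to_zero (\<lambda>k. a (\<phi> k))"
    using superlinear_subsequence[OF a_lim pos] by blast
  with \<zeta> show ?thesis unfolding a_def by blast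
qed

end
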